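(* Let $G$ be an $\mathfrak{sl}_3$ web (all of whose edges have weight $1$, so that every interior vertex is a source or a sink). Any two valid strandings of $G$ are related by a sequence of strand reversals.
   Context: Throughout, $n=3$. **Webs.** Fix a horizontal line in $\mathbb{R}^2$ (the boundary axis). A half-plane graph is a finite graph embedded in the closed half-plane below the boundary axis, up to planar isotopy fixing the axis, meeting the axis in a finite set of vertices (boundary vertices; all others are interior). For an oriented edge $e$ incident to $v$, $\sigma_v(e)=1$ if $e$ is directed into $v$ and $-1$ if out of $v$. An $\mathfrak{sl}_n$ web is a directed half-plane graph with edge weights in $\{1,\ldots,n-1\}$, univalent boundary vertices, trivalent interior vertices, and $\sum_{i=1}^3\sigma_v(e_i)\ell_i\equiv0\pmod n$ at each interior vertex $v$ with incident edges $e_i$ of weight $\ell_i$. **Strandings.** A curve system on $G$ is a collection of arcs (oriented simple paths in $G$ with both endpoints on the axis) and loops (oriented simple closed paths in $G$); orientations need not agree with those of the edges. A stranding $S$ of $G$ is a curve system whose curves (simple strands) are colored by $\{1,\ldots,n-1\}$ with same-colored curves pairwise disjoint. $S^+(e)$ (resp. $S^-(e)$) is the set of colors of simple strands directed with (resp. against) $e$; $S(e)=S^+(e)\sqcup S^-(e)$; $\alpha_c^\vee(S(e))=1,-1,0$ if $c\in S^+(e)$, $c\in S^-(e)$, $c\notin S(e)$. $S$ is valid if for each edge $e$ of weight $\ell$: the nonzero $\alpha_c^\vee(S(e))$ alternate in sign as $c$ increases, and with $c_{\max}=\max S(e)$, $\sum_c\alpha_c^\vee(S(e))c$ is $\ell$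 if $c_{\max}\in S^+(e)$ and $\ell-n$ if $c_{\max}\in S^-(e)$. For valid $S$, the binary label $b_S(e)\in\{0,1\}^n$ has $b_c-b_{c+1}=\alpha_c^\vee(S(e))$ for $1\le c<n$ and last entry $0$ if $c_{\max}\in S^+(e)$, $1$ if $c_{\max}\in S^-(e)$. The valid stranding $S$ is determined by the labeling $b_S$. **$(i,j)$-strands and strand reversal.** For $1\le i<j\le n$, the $(i,j)$-strands of $S$ are the connected components (arcs and loops) of the curve system traversing each edge $e=u\mapsto v$ with $b_S(e)=b_1\cdots b_n$ from $u$ to $v$ if $b_i-b_j=1$, from $v$ to $u$ if $b_i-b_j=-1$, not at all if $b_i=b_j$. Reversing an $(i,j)$-strand $\gamma$ of a valid stranding $S$ produces the (valid) stranding $S'$ whose binary labeling $b_{S'}$ agrees with $b_S$ on every edge not in $\gamma$ and swaps the $i$th and $j$th entries of $b_S(e)$ on every edge $e$ of $\gamma$. *)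

theory Defs
  imports
    "HOL-Analysis.Analysis"
    "HOL-Number_Theory.Cong"
    "Graph_Theory.Digraph"
begin

text \<open>
  The plane is \<^typ>\<open>complex\<close>, and the boundary axis is the real line.
\<close>

definition boundary_axis :: "complex set" where
  "boundary_axis = {z. Im z = 0}"

text \<open>
  A half-plane graph is a finite directed multigraph \<open>G\<close> whose vertices are points of the
  closed lower half-plane, together with a drawing \<open>\<phi>\<close>: the edge \<open>e\<close> is the simple
  path \<open>\<phi> e\<close> from its tail to its head.  Since the interior of every edge lies in the open
  half-plane, the graph meets the axis in vertices only.  Parallel edges are allowed.
\<close>

definition half_plane_graph ::
  "(complex, 'e) pre_digraph \<Rightarrow> ('e \<Rightarrow> real \<Rightarrow> complex) \<Rightarrow> bool" where
  "half_plane_graph G \<phi> \<longleftrightarrow>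
     fin_digraph G \<and>
     verts G \<subseteq> {z. Im z \<le> 0} \<and>
     (\<forall>e \<in> arcs G. simple_path (\<phi> e) \<and>
        pathstart (\<phi> e) = tail G e \<and> pathfinish (\<phi> e) = head G e \<and>
        \<phi> e ` {0<..<1} \<subseteq> {z. Im z < 0} - verts G) \<and>
     (\<forall>e \<in> arcs G. \<forall>e' \<in> arcs G. e \<noteq> e' \<longrightarrow>
        \<phi> e ` {0<..<1} \<inter> \<phi> e' ` {0<..<1} = {})"

definition sl_web ::
  "nat \<Rightarrow> (complex, 'e) pre_digraph \<Rightarrow> ('e \<Rightarrow> real \<Rightarrow> complex) \<Rightarrow> ('e \<Rightarrow> nat) \<Rightarrow> bool" where
  "sl_web n G \<phi> w \<longleftrightarrow>
     half_plane_graph G \<phi> \<and>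
     (\<forall>e \<in> arcs G. w e \<in> {1..<n}) \<and>
     (\<forall>v \<in> verts G \<inter> boundary_axis. in_degree G v + out_degree G v = 1) \<and>
     (\<forall>v \<in> verts G - boundary_axis.
        in_degree G v + out_degree G v = 3 \<and>
        [(\<Sum>e \<in> in_arcs G v. int (w e)) - (\<Sum>e \<in> out_arcs G v. int (w e)) = 0] (mod int n))"

text \<open>
  A dart \<open>(e, b)\<close> is the edge \<open>e\<close> traversed along its direction (\<open>b = True\<close>) or
  against it (\<open>b = False\<close>).  An oriented simple path, or an oriented simple closed path
  without base point, is determined by the set of darts that it traverses, and is represented
  by this set.
\<close>

type_synonym 'e dart = "'e \<times> bool"

fun dart_tail :: "('v, 'e) pre_digraph \<Rightarrow> 'e dart \<Rightarrow> 'v" where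
  "dart_tail G (e, b) = (if b then tail G e else head G e)"

fun dart_head :: "('v, 'e) pre_digraph \<Rightarrow> 'e dart \<Rightarrow> 'v" where
  "dart_head G (e, b) = (if b then head G e else tail G e)"

definition dart_walk :: "('v, 'e) pre_digraph \<Rightarrow> 'e dart list \<Rightarrow> bool" where
  "dart_walk G p \<longleftrightarrow>
     p \<noteq> [] \<and> fst ` set p \<subseteq> arcs G \<and>
     successively (\<lambda>d d'. dart_head G d = dart_tail G d') p"

definition arc_curves :: "(complex, 'e) pre_digraph \<Rightarrow> 'e dart set set" where
  "arc_curves G = {set p | p.
     dart_walk G p \<and>
     distinct (dart_tail G (hd p) # map (dart_head G) p) \<and>
     dart_tail G (hd p) \<in> boundary_axis \<and> dart_head G (last p) \<in> boundary_axis}"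

text \<open>
  Distinctness of the underlying edges excludes walking along an edge and straight back.
\<close>

definition loop_curves :: "('v, 'e) pre_digraph \<Rightarrow> 'e dart set set" where
  "loop_curves G = {set p | p.
     dart_walk G p \<and>
     dart_head G (last p) = dart_tail G (hd p) \<and>
     distinct (map (dart_head G) p) \<and> distinct (map fst p)}"

definition curve_verts :: "('v, 'e) pre_digraph \<Rightarrow> 'e dart set \<Rightarrow> 'v set" where
  "curve_verts G \<gamma> = dart_tail G ` \<gamma> \<union> dart_head G ` \<gamma>"

text \<open>
  A stranding is a set of pairs of a color and a curve.  Two curves in \<open>G\<close> are disjoint
  iff they have no common vertex.
\<close>

type_synonym 'e stranding = "(nat \<times> 'e dart set) set"

definition stranding :: "nat \<Rightarrow> (complex, 'e) pre_digraph \<Rightarrow> 'e stranding \<Rightarrow> bool" where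
  "stranding n G S \<longleftrightarrow>
     S \<subseteq> {1..<n} \<times> (arc_curves G \<union> loop_curves G) \<and>
     (\<forall>c \<gamma> \<gamma>'. (c, \<gamma>) \<in> S \<and> (c, \<gamma>') \<in> S \<and> \<gamma> \<noteq> \<gamma>' \<longrightarrow>
        curve_verts G \<gamma> \<inter> curve_verts G \<gamma>' = {})"

definition pos_colors :: "'e stranding \<Rightarrow> 'e \<Rightarrow> nat set" where
  "pos_colors S e = {c. \<exists>\<gamma>. (c, \<gamma>) \<in> S \<and> (e, True) \<in> \<gamma>}"

definition neg_colors :: "'e stranding \<Rightarrow> 'e \<Rightarrow> nat set" where
  "neg_colors S e = {c. \<exists>\<gamma>. (c, \<gamma>) \<in> S \<and> (e, False) \<in> \<gamma>}"

definition colors :: "'e stranding \<Rightarrow> 'e \<Rightarrow> nat set" where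
  "colors S e = pos_colors S e \<union> neg_colors S e"

definition coroot_sign :: "'e stranding \<Rightarrow> 'e \<Rightarrow> nat \<Rightarrow> int" where
  "coroot_sign S e c =
     (if c \<in> pos_colors S e then 1 else if c \<in> neg_colors S e then - 1 else 0)"

definition valid_stranding ::
  "nat \<Rightarrow> (complex, 'e) pre_digraph \<Rightarrow> ('e \<Rightarrow> nat) \<Rightarrow> 'e stranding \<Rightarrow> bool" where
  "valid_stranding n G w S \<longleftrightarrow>
     stranding n G S \<and>
     (\<forall>e \<in> arcs G.
        colors S e \<noteq> {} \<and>
        (\<forall>c \<in> colors S e. \<forall>c' \<in> colors S e.
           c < c' \<and> colors S e \<inter> {c<..<c'} = {} \<longrightarrow> coroot_sign S e c' = - coroot_sign S e c) \<and>
        (\<Sum>c = 1..<n. coroot_sign S e c * int c) =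
          (if Max (colors S e) \<in> pos_colors S e then int (w e) else int (w e) - int n))"

text \<open>
  The closed form of the binary label \<open>b\<^sub>1 \<dots> b\<^sub>n\<close> of an edge; the two lemmas after the
  definition are the conditions that determine it.
\<close>

definition binary_label :: "nat \<Rightarrow> 'e stranding \<Rightarrow> 'e \<Rightarrow> nat \<Rightarrow> int" where
  "binary_label n S e c =
     (if Max (colors S e) \<in> pos_colors S e then 0 else 1) + (\<Sum>k = c..<n. coroot_sign S e k)"

lemma binary_label_last:
  "binary_label n S e n = (if Max (colors S e) \<in> pos_colors S e then 0 else 1)"
  by (simp add: binary_label_def)

lemma binary_label_diff:
  "c < n \<Longrightarrow> binary_label n S e c - binary_label n S e (Suc c) = coroot_sign S e c"
  by (simp add: binary_label_def sum.atLeast_Suc_lessThan)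

definition strand_darts ::
  "nat \<Rightarrow> (complex, 'e) pre_digraph \<Rightarrow> 'e stranding \<Rightarrow> nat \<Rightarrow> nat \<Rightarrow> 'e dart set" where
  "strand_darts n G S i j =
     {(e, True) | e. e \<in> arcs G \<and> binary_label n S e i - binary_label n S e j = 1} \<union>
     {(e, False) | e. e \<in> arcs G \<and> binary_label n S e i - binary_label n S e j = - 1}"

text \<open>
  Connectedness ignores direction: two darts are adjacent iff they have a common end vertex.
\<close>

definition dart_components :: "('v, 'e) pre_digraph \<Rightarrow> 'e dart set \<Rightarrow> 'e dart set set" where
  "dart_components G D =
     D // {(d, d'). d \<in> D \<and> d' \<in> D \<and> curve_verts G {d} \<inter> curve_verts G {d'} \<noteq> {}}\<^sup>*"

definition strands ::
  "nat \<Rightarrow> (complex, 'e) pre_digraph \<Rightarrow> 'e stranding \<Rightarrow> nat \<Rightarrow> nat \<Rightarrow> 'e dart set set" where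
  "strands n G S i j = dart_components G (strand_darts n G S i j)"

definition reverses_strand ::
  "nat \<Rightarrow> (complex, 'e) pre_digraph \<Rightarrow> ('e \<Rightarrow> nat) \<Rightarrow> nat \<Rightarrow> nat \<Rightarrow> 'e dart set \<Rightarrow>
   'e stranding \<Rightarrow> 'e stranding \<Rightarrow> bool" where
  "reverses_strand n G w i j \<gamma> S S' \<longleftrightarrow>
     valid_stranding n G w S \<and> valid_stranding n G w S' \<and> \<gamma> \<in> strands n G S i j \<and>
     (\<forall>e \<in> arcs G. \<forall>k \<in> {1..n}.
        binary_label n S' e k =
          (if e \<in> fst ` \<gamma>
           then ((binary_label n S e)(i := binary_label n S e j, j := binary_label n S e i)) k
           else binary_label n S e k))"

definition strand_reversal ::
  "nat \<Rightarrow> (complex, 'e) pre_digraph \<Rightarrow> ('e \<Rightarrow> nat) \<Rightarrow> 'e stranding \<Rightarrow> 'e stranding \<Rightarrow> bool" where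
  "strand_reversal n G w S S' \<longleftrightarrow>
     (\<exists>i j \<gamma>. 1 \<le> i \<and> i < j \<and> j \<le> n \<and> reverses_strand n G w i j \<gamma> S S')"

end

(*
  A valid stranding of a web with all weights 1 is the same as a Tait coloring, i.e. a proper coloring
  of the edges by 1, 2, 3: every edge has the binary label 100, 010 or 001, and these differ at each
  vertex. The (i,j)-strands are the Kempe chains of the colors i and j, and reversing one is a Kempe
  change.

  Let h_i(z) be the sum of the winding numbers around z of the edges of color i, where boundary
  vertices are joined to a point above the axis. Since h_i - h_j is the sum of the winding numbers of
  the (i,j)-strands, which are Jordan curves, and since (h_1, h_2, h_3) modulo integers and the sum
  h_1 + h_2 + h_3 do not depend on the coloring, a coloring becomes a map from the faces of the web
  to the weight lattice of type A2. Reversing suitable (i,j)-strands reduces h_i - h_j modulo 2, which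
  folds this map along mirrors of the affine Weyl group. Repeating this for the three pairs of colors
  ends with all faces in one alcove, where the heights, and therefore the coloring, are unique.
*)
theory Submission
  imports Defs "HOL-Complex_Analysis.Winding_Numbers"
begin

subsection \<open>Components of a set of darts\<close>

text \<open>Faces never occur as objects: the points of the lower half-plane off the graph stand for
  them, and every statement about levels is pointwise. A single edge is not a closed path, so its
  winding number is no integer; heights become integers only relative to a base function common to
  all colors and colorings. Folding must act at all points at once, although only whole strands can
  be reversed. This is possible because the strands of one pair of colors are disjoint Jordan
  curves: along a strand the total winding of the others is constant, so one sign per strand makes
  its jump equal to the jump of the parity. Folding for one pair can spoil another pair. Progress is
  measured by the squared distance to the barycentre of the alcove, which drops at every point that
  a fold moves and is bounded over all points in terms of the number of strands. Since swapping
  twice changes nothing, a path to a folded coloring can also be walked back.\<close>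

definition dart_adj :: "('v, 'e) pre_digraph \<Rightarrow> 'e dart set \<Rightarrow> ('e dart \<times> 'e dart) set" where
  "dart_adj G D =
     {(d, d'). d \<in> D \<and> d' \<in> D \<and> curve_verts G {d} \<inter> curve_verts G {d'} \<noteq> {}}"

lemma dart_components_altdef: "dart_components G D = (\<lambda>d. (dart_adj G D)\<^sup>* `` {d}) ` D"
  by (auto simp: dart_components_def dart_adj_def quotient_def)

lemma sym_dart_adj: "sym ((dart_adj G D)\<^sup>*)"
  by (rule sym_rtrancl) (auto simp: dart_adj_def sym_def)

lemma curve_verts_eq_UN: "curve_verts G C = (\<Union>d\<in>C. curve_verts G {d})"
  by (auto simp: curve_verts_def)

lemma curve_verts_single: "curve_verts G {d} = {dart_tail G d, dart_head G d}"
  by (auto simp: curve_verts_def)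

lemma curve_verts_dart: "curve_verts G {(e, b)} = {tail G e, head G e}"
  by (auto simp: curve_verts_def)

lemma dart_component_subset:
  assumes "C \<in> dart_components G D" shows "C \<subseteq> D"
proof
  fix y assume "y \<in> C"
  with assms obtain x where "x \<in> D" "(x, y) \<in> (dart_adj G D)\<^sup>*"
    by (auto simp: dart_components_altdef)
  from this(2,1) show "y \<in> D"
    by (induction rule: rtrancl_induct) (auto simp: dart_adj_def)
qed

lemma dart_component_nonempty: "C \<in> dart_components G D \<Longrightarrow> C \<noteq> {}"
  by (auto simp: dart_components_altdef)

lemma dart_component_eq_Image:
  assumes "C \<in> dart_components G D" "d \<in> C"
  shows "C = (dart_adj G D)\<^sup>* `` {d}"
proof -
  from assms obtain x where x: "C = (dart_adj G D)\<^sup>* `` {x}" "(x, d) \<in> (dart_adj G D)\<^sup>*"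
    by (auto simp: dart_components_altdef)
  moreover have "(d, x) \<in> (dart_adj G D)\<^sup>*"
    using x(2) sym_dart_adj by (metis symD)
  ultimately show ?thesis
    by (auto intro: rtrancl_trans)
qed

lemma dart_components_cover:
  assumes "d \<in> D" obtains C where "C \<in> dart_components G D" "d \<in> C"
  using assms by (auto simp: dart_components_altdef)

lemma Union_dart_components: "\<Union>(dart_components G D) = D"
  by (meson UnionI Union_least dart_component_subset dart_components_cover subsetI subset_antisym)

lemma dart_component_closed:
  assumes "C \<in> dart_components G D" "d \<in> C" "d' \<in> D"
    "curve_verts G {d} \<inter> curve_verts G {d'} \<noteq> {}"
  shows "d' \<in> C"
proof -
  have "(d, d') \<in> dart_adj G D"
    using assms dart_component_subset[OF assms(1)] by (auto simp: dart_adj_def)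
  then show ?thesis
    using dart_component_eq_Image[OF assms(1,2)] by auto
qed

lemma dart_components_disjoint:
  assumes "C \<in> dart_components G D" "C' \<in> dart_components G D" "C \<noteq> C'"
  shows "curve_verts G C \<inter> curve_verts G C' = {}"
proof (rule ccontr)
  assume "curve_verts G C \<inter> curve_verts G C' \<noteq> {}"
  then obtain d d' where d: "d \<in> C" "d' \<in> C'" "curve_verts G {d} \<inter> curve_verts G {d'} \<noteq> {}"
    by (subst (asm) (1 2) curve_verts_eq_UN) blast
  then have "d' \<in> C"
    using dart_component_closed[OF assms(1) d(1)] dart_component_subset[OF assms(2)] by blast
  then show False
    using assms d dart_component_eq_Image by metis
qed

text \<open>Chains of adjacent darts from \<open>d\<close> reach the whole component and cannot
  leave a set closed under adjacency. This bounds components from above, as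
  \<open>dart_component_closed\<close> does from below.\<close>

lemma dart_component_least:
  assumes "C \<in> dart_components G D" "d \<in> C" "d \<in> A"
    and closed: "\<And>x y. x \<in> A \<Longrightarrow> y \<in> D \<Longrightarrow> curve_verts G {x} \<inter> curve_verts G {y} \<noteq> {} \<Longrightarrow> y \<in> A"
  shows "C \<subseteq> A"
proof
  fix y assume "y \<in> C"
  then have "(d, y) \<in> (dart_adj G D)\<^sup>*"
    using dart_component_eq_Image[OF assms(1,2)] by auto
  then show "y \<in> A"
    using \<open>d \<in> A\<close> by (induction rule: rtrancl_induct) (auto simp: dart_adj_def intro: closed)
qed

text \<open>No adjacency joins two vertex-disjoint pieces, and each piece is connected by itself, so
  the pieces are the classes. It serves to recover the curves of a stranding from the union of their
  darts.\<close>

lemma dart_components_eqI: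
  assumes D: "D = \<Union>\<C>"
    and ne: "\<And>C. C \<in> \<C> \<Longrightarrow> C \<noteq> {}"
    and conn: "\<And>C d d'. C \<in> \<C> \<Longrightarrow> d \<in> C \<Longrightarrow> d' \<in> C \<Longrightarrow> (d, d') \<in> (dart_adj G C)\<^sup>*"
    and disj: "\<And>C C'. C \<in> \<C> \<Longrightarrow> C' \<in> \<C> \<Longrightarrow> C \<noteq> C' \<Longrightarrow> curve_verts G C \<inter> curve_verts G C' = {}"
  shows "dart_components G D = \<C>"
proof -
  have img: "(dart_adj G D)\<^sup>* `` {d} = C" if "C \<in> \<C>" "d \<in> C" for C d
  proof
    have "dart_adj G C \<subseteq> dart_adj G D"
      using that D by (auto simp: dart_adj_def)
    then show "C \<subseteq> (dart_adj G D)\<^sup>* `` {d}"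
      using conn[OF that] rtrancl_mono by blast
    show "(dart_adj G D)\<^sup>* `` {d} \<subseteq> C"
    proof
      fix y assume "y \<in> (dart_adj G D)\<^sup>* `` {d}"
      then have "(d, y) \<in> (dart_adj G D)\<^sup>*" by simp
      then show "y \<in> C"
      proof (induction rule: rtrancl_induct)
        case (step y z)
        then obtain C' where "C' \<in> \<C>" "z \<in> C'" and m: "curve_verts G {y} \<inter> curve_verts G {z} \<noteq> {}"
          using D by (auto simp: dart_adj_def)
        moreover have "curve_verts G {y} \<subseteq> curve_verts G C" "curve_verts G {z} \<subseteq> curve_verts G C'"
          using step \<open>z \<in> C'\<close> by (auto simp: curve_verts_def)
        ultimately have "C' = C"
          using disj[OF \<open>C \<in> \<C>\<close> \<open>C' \<in> \<C>\<close>] by blast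
        with \<open>z \<in> C'\<close> show ?case by simp
      qed (use that in simp)
    qed
  qed
  show ?thesis
    unfolding dart_components_altdef
  proof (intro set_eqI iffI)
    fix C assume "C \<in> (\<lambda>d. (dart_adj G D)\<^sup>* `` {d}) ` D"
    then show "C \<in> \<C>" using D img by auto
  next
    fix C assume "C \<in> \<C>"
    moreover from ne[OF this] obtain d where "d \<in> C" by blast
    ultimately show "C \<in> (\<lambda>d. (dart_adj G D)\<^sup>* `` {d}) ` D" using D img by blast
  qed
qed

subsection \<open>Dart walks\<close>

lemma dart_walk_Nil [simp]: "\<not> dart_walk G []"
  by (simp add: dart_walk_def)

lemma dart_walk_Cons:
  "dart_walk G (d # p) \<longleftrightarrow>
     fst d \<in> arcs G \<and> (p = [] \<or> dart_walk G p \<and> dart_head G d = dart_tail G (hd p))"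
  by (cases p) (auto simp: dart_walk_def)

lemma dart_walk_append:
  assumes "p \<noteq> []" "q \<noteq> []"
  shows "dart_walk G (p @ q) \<longleftrightarrow>
     dart_walk G p \<and> dart_walk G q \<and> dart_head G (last p) = dart_tail G (hd q)"
  using assms by (auto simp: dart_walk_def successively_append_iff)

lemma dart_walk_connected:
  assumes "dart_walk G p" "d \<in> set p" "d' \<in> set p"
  shows "(d, d') \<in> (dart_adj G (set p))\<^sup>*"
proof -
  have *: "(hd p, d) \<in> (dart_adj G (set p))\<^sup>*" if "dart_walk G p" "d \<in> set p" for p d
    using that
  proof (induction p)
    case (Cons x p)
    show ?case
    proof (cases "d = x")
      case False
      then have d: "d \<in> set p" "p \<noteq> []" "dart_walk G p" "dart_head G x = dart_tail G (hd p)"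
        using Cons.prems by (auto simp: dart_walk_Cons)
      have "(hd p, d) \<in> (dart_adj G (set (x # p)))\<^sup>*"
        by (rule rtrancl_mono[THEN subsetD, OF _ Cons.IH[OF d(3,1)]]) (auto simp: dart_adj_def)
      moreover have "(x, hd p) \<in> dart_adj G (set (x # p))"
        using d by (auto simp: dart_adj_def curve_verts_single)
      ultimately show ?thesis by (auto intro: converse_rtrancl_into_rtrancl)
    qed auto
  qed auto
  show ?thesis
    by (rule rtrancl_trans[of _ "hd p"]) (use assms * sym_dart_adj in \<open>metis symD\<close>)+
qed

lemma dart_walk_tails:
  assumes "dart_walk G p"
  shows "map (dart_tail G) p = dart_tail G (hd p) # butlast (map (dart_head G) p)"
  using assms by (induction p) (auto simp: dart_walk_Cons)

text \<open>The start of an arc is the head of none of its darts, which settles the case where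
  \<open>d\<close> or \<open>d'\<close> is the leading dart; the rest is again an arc. The lemma
  yields distinct edges for arcs, whose definition asks only for distinct vertices.\<close>

lemma arc_walk_no_backtrack:
  assumes "dart_walk G p" "distinct (dart_tail G (hd p) # map (dart_head G) p)"
    "d \<in> set p" "d' \<in> set p" "dart_tail G d' = dart_head G d"
  shows "dart_head G d' \<noteq> dart_tail G d"
  using assms
proof (induction p)
  case (Cons x p)
  show ?case
  proof (cases "d = x \<or> d' = x")
    case True
    moreover have "dart_head G y \<noteq> dart_tail G x" if "y \<in> set (x # p)" for y
      using Cons.prems(2) that by force
    ultimately show ?thesis using Cons.prems by metis
  next
    case False
    then have "p \<noteq> []" "d \<in> set p" "d' \<in> set p" using Cons.prems by auto
    then show ?thesis using Cons by (auto simp: dart_walk_Cons)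
  qed
qed simp

text \<open>A common form for arcs and loops: at most one dart enters each vertex, at most one
  leaves it, and no edge is used twice.\<close>

lemma curve_walkE:
  assumes "C \<in> arc_curves G \<union> loop_curves G"
  obtains p where "C = set p" "dart_walk G p" "distinct (map (dart_head G) p)"
    "distinct (map (dart_tail G) p)" "inj_on fst (set p)"
proof -
  consider "C \<in> arc_curves G" | "C \<in> loop_curves G" using assms by blast
  then show thesis
  proof cases
    case 1
    then obtain p where p: "C = set p" "dart_walk G p"
        "distinct (dart_tail G (hd p) # map (dart_head G) p)"
      by (auto simp: arc_curves_def)
    have "distinct (map (dart_tail G) p)"
      using p dart_walk_tails[OF p(2)] by (auto simp: distinct_butlast dest: in_set_butlastD)
    moreover have "inj_on fst (set p)"
    proof (rule inj_onI)
      fix d d' assume d: "d \<in> set p" "d' \<in> set p" "fst d = fst d'"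
      obtain e b b' where [simp]: "d = (e, b)" "d' = (e, b')"
        using d(3) by (metis prod.collapse)
      show "d = d'"
        using arc_walk_no_backtrack[OF p(2,3) d(1,2)] by (cases b; cases b') auto
    qed
    ultimately show ?thesis using that p by auto
  next
    case 2
    then obtain p where p: "C = set p" "dart_walk G p" "dart_head G (last p) = dart_tail G (hd p)"
        "distinct (map (dart_head G) p)" "distinct (map fst p)"
      by (auto simp: loop_curves_def)
    have "p \<noteq> []" using p by (auto simp: dart_walk_def)
    \<comment> \<open>On a closed walk the tails are the heads rotated by one place, so distinctness
      carries over.\<close>
    then have heads: "map (dart_head G) p = butlast (map (dart_head G) p) @ [dart_tail G (hd p)]"
      using p(3) by (metis append_butlast_last_id last_map map_is_Nil_conv)
    have "distinct (map (dart_tail G) p)"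
      using p(4) unfolding dart_walk_tails[OF p(2)] by (subst (asm) heads) auto
    then show ?thesis using that p by (auto simp: distinct_map)
  qed
qed

lemma curve_connected:
  assumes "C \<in> arc_curves G \<union> loop_curves G" "d \<in> C" "d' \<in> C"
  shows "(d, d') \<in> (dart_adj G C)\<^sup>*"
  using assms curve_walkE dart_walk_connected by metis

lemma curve_nonempty: "C \<in> arc_curves G \<union> loop_curves G \<Longrightarrow> C \<noteq> {}"
  by (erule curve_walkE) (auto simp: dart_walk_def)

lemma curve_arcs: "C \<in> arc_curves G \<union> loop_curves G \<Longrightarrow> fst ` C \<subseteq> arcs G"
  by (erule curve_walkE) (auto simp: dart_walk_def)

lemma curve_inj_head: "C \<in> arc_curves G \<union> loop_curves G \<Longrightarrow> inj_on (dart_head G) C"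
  by (erule curve_walkE) (auto simp: distinct_map)

lemma curve_inj_tail: "C \<in> arc_curves G \<union> loop_curves G \<Longrightarrow> inj_on (dart_tail G) C"
  by (erule curve_walkE) (auto simp: distinct_map)

lemma curve_inj_fst: "C \<in> arc_curves G \<union> loop_curves G \<Longrightarrow> inj_on fst C"
  by (erule curve_walkE) auto

text \<open>A longest walk without repeated darts inside \<open>C\<close> absorbs every dart that
  meets it: injectivity leaves one candidate at each vertex, and maximality forbids an extension at
  the ends. So it exhausts \<open>C\<close>. If it does not close up, its ends have no continuation,
  and \<open>succ\<close> and \<open>pred\<close> place them on the axis.\<close>

lemma balanced_component_curve:
  assumes fin: "finite D" and arcs: "fst ` D \<subseteq> arcs G"
    and injt: "inj_on (dart_tail G) D" and injh: "inj_on (dart_head G) D" and injf: "inj_on fst D"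
    and succ: "\<And>d. d \<in> D \<Longrightarrow> dart_head G d \<notin> boundary_axis \<Longrightarrow> \<exists>d'\<in>D. dart_tail G d' = dart_head G d"
    and pred: "\<And>d. d \<in> D \<Longrightarrow> dart_tail G d \<notin> boundary_axis \<Longrightarrow> \<exists>d'\<in>D. dart_head G d' = dart_tail G d"
    and C: "C \<in> dart_components G D"
  shows "C \<in> arc_curves G \<union> loop_curves G"
proof -
  have CD: "C \<subseteq> D" using dart_component_subset[OF C] .
  define P where "P p \<longleftrightarrow> dart_walk G p \<and> set p \<subseteq> C \<and> distinct p" for p
  obtain d0 where "d0 \<in> C" using dart_component_nonempty[OF C] by blast
  then have "P [d0]" using CD arcs by (auto simp: P_def dart_walk_def)
  moreover have "length p < Suc (card C)" if "P p" for p
    using that finite_subset[OF CD fin] card_mono[of C "set p"] by (auto simp: P_def distinct_card)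
  ultimately obtain p where p: "P p" and max: "\<And>q. P q \<Longrightarrow> length q \<le> length p"
    using ex_has_greatest_nat[of P "[d0]" length "Suc (card C)"] by (metis less_imp_le)
  have walk: "dart_walk G p" and pC: "set p \<subseteq> C" and dist: "distinct p" and ne: "p \<noteq> []"
    using p by (auto simp: P_def dart_walk_def)
  have pD: "set p \<subseteq> D" using pC CD by blast
  have closed: "d \<in> C" if "d' \<in> set p" "d \<in> D" "curve_verts G {d'} \<inter> curve_verts G {d} \<noteq> {}" for d d'
    using dart_component_closed[OF C _ that(2,3)] pC that(1) by blast
  have heads: "distinct (map (dart_head G) p)" and tails: "distinct (map (dart_tail G) p)"
    and fsts: "distinct (map fst p)"
    using dist injh injt injf pD by (auto simp: distinct_map intro: inj_on_subset)
  have next_in: "d \<in> set p" if "d \<in> D" "dart_tail G d = dart_head G (last p)" for d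
  proof (rule ccontr)
    assume "d \<notin> set p"
    moreover have "d \<in> C"
      using closed[of "last p" d] that ne by (auto simp: curve_verts_single)
    ultimately have "P (p @ [d])"
      using walk pC dist that ne arcs by (auto simp: P_def dart_walk_append dart_walk_Cons)
    from max[OF this] show False by simp
  qed
  have prev_in: "d \<in> set p" if "d \<in> D" "dart_head G d = dart_tail G (hd p)" for d
  proof (rule ccontr)
    assume "d \<notin> set p"
    moreover have "d \<in> C"
      using closed[of "hd p" d] that ne by (auto simp: curve_verts_single)
    ultimately have "P (d # p)"
      using walk pC dist that ne arcs by (auto simp: P_def dart_walk_Cons)
    from max[OF this] show False by simp
  qed
  \<comment> \<open>Within the walk the next entry already starts at the head of \<open>d\<close>,
    and injectivity of tails admits no other dart there.\<close>
  have succ_p: "d' \<in> set p" if "d \<in> set p" "d' \<in> D" "dart_tail G d' = dart_head G d" for d d'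
  proof (cases "d = last p")
    case False
    then obtain k where k: "d = p ! k" "Suc k < length p"
      using \<open>d \<in> set p\<close> by (metis Suc_lessI diff_Suc_1 in_set_conv_nth last_conv_nth ne)
    then have "dart_tail G (p ! Suc k) = dart_head G d"
      using walk by (auto simp: dart_walk_def successively_conv_nth)
    then have "d' = p ! Suc k"
      using that pD k injt by (metis inj_onD nth_mem subsetD)
    then show ?thesis using k by simp
  qed (use that next_in in auto)
  have pred_p: "d' \<in> set p" if "d \<in> set p" "d' \<in> D" "dart_head G d' = dart_tail G d" for d d'
  proof (cases "d = hd p")
    case False
    then obtain k where k: "d = p ! Suc k" "Suc k < length p"
      using \<open>d \<in> set p\<close> by (metis hd_conv_nth in_set_conv_nth ne not0_implies_Suc)
    then have "dart_head G (p ! k) = dart_tail G d"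
      using walk by (auto simp: dart_walk_def successively_conv_nth)
    then have "d' = p ! k"
      using that pD k injh by (metis Suc_lessD inj_onD nth_mem subsetD)
    then show ?thesis using k by simp
  qed (use that prev_in in auto)
  have "C \<subseteq> set p"
  proof (rule dart_component_least[OF C])
    show "hd p \<in> C" "hd p \<in> set p" using ne pC by auto
    fix x y assume xy: "x \<in> set p" "y \<in> D" "curve_verts G {x} \<inter> curve_verts G {y} \<noteq> {}"
    then consider "dart_tail G x = dart_tail G y" | "dart_head G x = dart_head G y"
      | "dart_head G x = dart_tail G y" | "dart_tail G x = dart_head G y"
      by (auto simp: curve_verts_single)
    then show "y \<in> set p"
      using xy pD succ_p[OF xy(1,2)] pred_p[OF xy(1,2)] injt injh by cases (auto dest: inj_onD)
  qed
  with pC have C_eq: "C = set p" by blast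
  show ?thesis
  proof (cases "dart_head G (last p) = dart_tail G (hd p)")
    case True
    then show ?thesis using C_eq walk heads fsts by (auto simp: loop_curves_def)
  next
    case False
    \<comment> \<open>A dart into the start would lie in \<open>p\<close> without being last, so the
      entry after it would have the same tail as \<open>hd p\<close>.\<close>
    have no_prev: "dart_head G d \<noteq> dart_tail G (hd p)" if "d \<in> D" for d
    proof
      assume eq: "dart_head G d = dart_tail G (hd p)"
      then have "d \<in> set p" using prev_in that by blast
      moreover have "d \<noteq> last p" using False eq by auto
      ultimately obtain k where k: "d = p ! k" "Suc k < length p"
        by (metis Suc_lessI diff_Suc_1 in_set_conv_nth last_conv_nth ne)
      then have "dart_tail G (p ! Suc k) = dart_tail G (p ! 0)"
        using walk eq ne by (auto simp: dart_walk_def successively_conv_nth hd_conv_nth)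
      then show False
        using tails k nth_eq_iff_index_eq[OF tails, of "Suc k" 0] by (simp add: ne)
    qed
    then have 1: "distinct (dart_tail G (hd p) # map (dart_head G) p)"
      using heads pD by fastforce
    have 2: "dart_tail G (hd p) \<in> boundary_axis"
      using no_prev pred[of "hd p"] pD ne by (meson hd_in_set subsetD)
    have 3: "dart_head G (last p) \<in> boundary_axis"
    proof (rule ccontr)
      assume "dart_head G (last p) \<notin> boundary_axis"
      then obtain d where d: "d \<in> D" "dart_tail G d = dart_head G (last p)"
        using succ[of "last p"] pD ne by (meson last_in_set subsetD)
      then have "d \<in> set p" using next_in by blast
      moreover have "d \<noteq> hd p" using False d by auto
      ultimately obtain k where k: "d = p ! Suc k" "Suc k < length p"
        by (metis hd_conv_nth in_set_conv_nth ne not0_implies_Suc)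
      then have "dart_head G (p ! k) = dart_head G (p ! (length p - 1))"
        using walk d ne by (auto simp: dart_walk_def successively_conv_nth last_conv_nth)
      then show False
        using k nth_eq_iff_index_eq[OF heads, of k "length p - 1"] by (simp add: ne)
    qed
    show ?thesis using C_eq walk 1 2 3 by (auto simp: arc_curves_def)
  qed
qed

subsection \<open>Webs whose edges all have weight 1\<close>

definition incident :: "('v, 'e) pre_digraph \<Rightarrow> 'v \<Rightarrow> 'e set" where
  "incident G v = {e \<in> arcs G. tail G e = v \<or> head G e = v}"

definition tait_coloring :: "('v, 'e) pre_digraph \<Rightarrow> ('e \<Rightarrow> nat) \<Rightarrow> bool" where
  "tait_coloring G c \<longleftrightarrow>
     (\<forall>e\<in>arcs G. c e \<in> {1, 2, 3}) \<and> (\<forall>v\<in>verts G. inj_on c (incident G v))"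

text \<open>Along a Kempe chain sources and sinks alternate and so do the two colors; walking color
  \<open>i\<close> forward and color \<open>j\<close> backward orients the chain
  consistently.\<close>

definition kempe_darts :: "('v, 'e) pre_digraph \<Rightarrow> ('e \<Rightarrow> nat) \<Rightarrow> nat \<Rightarrow> nat \<Rightarrow> 'e dart set" where
  "kempe_darts G c i j =
     {(e, True) | e. e \<in> arcs G \<and> c e = i} \<union> {(e, False) | e. e \<in> arcs G \<and> c e = j}"

text \<open>Strand color \<open>k\<close> carries the strands for the pair \<open>k\<close>,
  \<open>Suc k\<close>, because the difference of these two entries of the binary label is the sign
  of \<open>k\<close>.\<close>

definition coloring_stranding :: "('v, 'e) pre_digraph \<Rightarrow> ('e \<Rightarrow> nat) \<Rightarrow> 'e stranding" where
  "coloring_stranding G c =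
     {(k, \<gamma>). k \<in> {1, 2} \<and> \<gamma> \<in> dart_components G (kempe_darts G c k (Suc k))}"

definition swap_colors :: "('e \<Rightarrow> nat) \<Rightarrow> nat \<Rightarrow> nat \<Rightarrow> 'e set \<Rightarrow> 'e \<Rightarrow> nat" where
  "swap_colors c i j U e =
     (if e \<in> U then (if c e = i then j else if c e = j then i else c e) else c e)"

text \<open>These are the edge sets of unions of strands, described by closure under adjacency
  instead of by a list of components.\<close>

definition kempe_closed :: "('v, 'e) pre_digraph \<Rightarrow> ('e \<Rightarrow> nat) \<Rightarrow> nat \<Rightarrow> nat \<Rightarrow> 'e set \<Rightarrow> bool" where
  "kempe_closed G c i j U \<longleftrightarrow>
     U \<subseteq> {e \<in> arcs G. c e \<in> {i, j}} \<and>
     (\<forall>e\<in>U. \<forall>e'\<in>arcs G. c e' \<in> {i, j} \<and> {tail G e, head G e} \<inter> {tail G e', head G e'} \<noteq> {} \<longrightarrow> e' \<in> U)"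

lemma mem_kempe_darts [simp]:
  "(e, b) \<in> kempe_darts G c i j \<longleftrightarrow> e \<in> arcs G \<and> c e = (if b then i else j)"
  by (auto simp: kempe_darts_def)

lemma kempe_darts_cong:
  "(\<And>e. e \<in> arcs G \<Longrightarrow> c e = c' e) \<Longrightarrow> kempe_darts G c i j = kempe_darts G c' i j"
  by (auto simp: kempe_darts_def)

lemma coloring_stranding_cong:
  "(\<And>e. e \<in> arcs G \<Longrightarrow> c e = c' e) \<Longrightarrow> coloring_stranding G c = coloring_stranding G c'"
  using kempe_darts_cong[of G c c'] by (simp add: coloring_stranding_def)

lemma kempe_closed_UN:
  assumes "\<And>x. x \<in> A \<Longrightarrow> kempe_closed G c i j (V x)"
  shows "kempe_closed G c i j (\<Union>x\<in>A. V x)"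
  unfolding kempe_closed_def
proof (intro conjI ballI impI)
  show "(\<Union>x\<in>A. V x) \<subseteq> {e \<in> arcs G. c e \<in> {i, j}}"
    using assms by (simp add: kempe_closed_def UN_least)
  fix e e' assume "e \<in> (\<Union>x\<in>A. V x)" and e': "e' \<in> arcs G"
    "c e' \<in> {i, j} \<and> {tail G e, head G e} \<inter> {tail G e', head G e'} \<noteq> {}"
  then obtain x where x: "x \<in> A" "e \<in> V x" by blast
  then have "e' \<in> V x" using assms[OF x(1)] e' unfolding kempe_closed_def by blast
  then show "e' \<in> (\<Union>x\<in>A. V x)" using x by blast
qed

lemma atLeastLessThan_1_3: "{1..<3} = {1, 2::nat}"
  by auto

locale unit_sl3_web =
  fixes G :: "(complex, 'e) pre_digraph"
    and \<phi> :: "'e \<Rightarrow> real \<Rightarrow> complex"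
    and w :: "'e \<Rightarrow> nat"
  assumes sl3: "sl_web 3 G \<phi> w" and unit: "\<forall>e\<in>arcs G. w e = 1"
begin

lemma half_plane: "half_plane_graph G \<phi>"
  using sl3 by (simp add: sl_web_def)

lemma fin_digraph: "fin_digraph G"
  using half_plane by (simp add: half_plane_graph_def)

lemmas finite_arcs [simp] = fin_digraph.finite_arcs[OF fin_digraph]

lemmas tail_in_verts [simp] =
  wf_digraph.tail_in_verts[OF fin_digraph.axioms(1)[OF fin_digraph]]

lemmas head_in_verts [simp] =
  wf_digraph.head_in_verts[OF fin_digraph.axioms(1)[OF fin_digraph]]

lemma boundary_degree:
  "v \<in> verts G \<Longrightarrow> v \<in> boundary_axis \<Longrightarrow> card (in_arcs G v) + card (out_arcs G v) = 1"
  using sl3 by (simp add: sl_web_def in_degree_def out_degree_def)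

text \<open>With unit weights the congruence makes in-degree and out-degree differ by a multiple of
  3, while they add up to 3; this excludes 2 + 1.\<close>

lemma interior_degree:
  assumes "v \<in> verts G" "v \<notin> boundary_axis"
  shows "card (in_arcs G v) = 3 \<and> card (out_arcs G v) = 0 \<or>
         card (in_arcs G v) = 0 \<and> card (out_arcs G v) = 3"
proof -
  have sum: "card (in_arcs G v) + card (out_arcs G v) = 3"
    and cong: "[(\<Sum>e \<in> in_arcs G v. int (w e)) - (\<Sum>e \<in> out_arcs G v. int (w e)) = 0] (mod 3)"
    using sl3 assms by (auto simp: sl_web_def in_degree_def out_degree_def)
  have "(\<Sum>e \<in> in_arcs G v. int (w e)) = int (card (in_arcs G v))"
       "(\<Sum>e \<in> out_arcs G v. int (w e)) = int (card (out_arcs G v))"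
    using unit by (simp_all add: in_arcs_def out_arcs_def)
  with cong have "(int (card (in_arcs G v)) - int (card (out_arcs G v))) mod 3 = 0"
    by (simp add: cong_def)
  with sum show ?thesis by presburger
qed

lemma finite_in_out [simp]: "finite (in_arcs G v)" "finite (out_arcs G v)"
  by (simp_all add: in_arcs_def out_arcs_def)

text \<open>Mixed vertices are excluded by \<open>interior_degree\<close> off the axis and by degree
  1 on it. In particular no edge is a self-loop.\<close>

lemma source_sink: "e \<in> arcs G \<Longrightarrow> e' \<in> arcs G \<Longrightarrow> head G e \<noteq> tail G e'"
proof
  assume e: "e \<in> arcs G" "e' \<in> arcs G" and eq: "head G e = tail G e'"
  let ?v = "head G e"
  have "e \<in> in_arcs G ?v" "e' \<in> out_arcs G ?v" using e eq by auto
  then have "card (in_arcs G ?v) > 0" "card (out_arcs G ?v) > 0"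
    by (auto simp: card_gt_0_iff)
  then show False
    using boundary_degree[of ?v] interior_degree[of ?v] head_in_verts[OF e(1)] by linarith
qed

lemma tail_neq_head: "e \<in> arcs G \<Longrightarrow> tail G e \<noteq> head G e"
  using source_sink by metis

lemma source_sink': "e \<in> arcs G \<Longrightarrow> e' \<in> arcs G \<Longrightarrow> tail G e \<noteq> head G e'"
  using source_sink by metis

section \<open>Colors at a vertex, and strands of a coloring as arcs and loops\<close>

lemma tait_colors: "tait_coloring G c \<Longrightarrow> e \<in> arcs G \<Longrightarrow> c e \<in> {1, 2, 3}"
  by (simp add: tait_coloring_def)

lemma tait_inj:
  assumes "tait_coloring G c" "e \<in> arcs G" "e' \<in> arcs G" "c e = c e'"
    "tail G e = tail G e' \<or> head G e = head G e'"
  shows "e = e'"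
proof -
  obtain v where "v \<in> verts G" "e \<in> incident G v" "e' \<in> incident G v"
    using assms(5) that[of "tail G e"] that[of "head G e"] assms(2,3) by (auto simp: incident_def)
  then show ?thesis using assms by (auto simp: tait_coloring_def dest: inj_onD)
qed

text \<open>Three edges with distinct colors out of three must use each color.\<close>

lemma tait_ex_head:
  assumes c: "tait_coloring G c" and e: "e \<in> arcs G" "head G e \<notin> boundary_axis" and k: "k \<in> {1, 2, 3}"
  shows "\<exists>e'\<in>arcs G. head G e' = head G e \<and> c e' = k"
proof -
  let ?I = "in_arcs G (head G e)"
  have "card ?I \<noteq> 0" using e by (auto simp: card_eq_0_iff)
  then have "card ?I = 3" using interior_degree[of "head G e"] e by auto
  moreover have "inj_on c ?I" using tait_inj[OF c] by (auto intro!: inj_onI)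
  ultimately have "card (c ` ?I) = card {1, 2, 3::nat}" by (simp add: card_image)
  moreover have "c ` ?I \<subseteq> {1, 2, 3}"
    by (intro image_subsetI tait_colors[OF c]) simp
  ultimately have "c ` ?I = {1, 2, 3}" by (metis card_subset_eq finite.emptyI finite.insertI)
  then obtain e' where "e' \<in> ?I" "c e' = k" using k by (metis imageE)
  then show ?thesis by auto
qed

lemma tait_ex_tail:
  assumes c: "tait_coloring G c" and e: "e \<in> arcs G" "tail G e \<notin> boundary_axis" and k: "k \<in> {1, 2, 3}"
  shows "\<exists>e'\<in>arcs G. tail G e' = tail G e \<and> c e' = k"
proof -
  let ?I = "out_arcs G (tail G e)"
  have "card ?I \<noteq> 0" using e by (auto simp: card_eq_0_iff)
  then have "card ?I = 3" using interior_degree[of "tail G e"] e by auto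
  moreover have "inj_on c ?I" using tait_inj[OF c] by (auto intro!: inj_onI)
  ultimately have "card (c ` ?I) = card {1, 2, 3::nat}" by (simp add: card_image)
  moreover have "c ` ?I \<subseteq> {1, 2, 3}"
    by (intro image_subsetI tait_colors[OF c]) simp
  ultimately have "c ` ?I = {1, 2, 3}" by (metis card_subset_eq finite.emptyI finite.insertI)
  then obtain e' where "e' \<in> ?I" "c e' = k" using k by (metis imageE)
  then show ?thesis by auto
qed

lemma finite_kempe_darts [simp]: "finite (kempe_darts G c i j)"
  by (rule finite_subset[of _ "arcs G \<times> UNIV"]) auto

text \<open>A dart of color \<open>i\<close> runs into a sink, and off the axis exactly one edge of
  color \<open>j\<close> lets it leave backward; at sources the roles are exchanged. So the darts
  satisfy the balance conditions.\<close>

lemma kempe_component_curve: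
  assumes c: "tait_coloring G c" and ij: "i \<in> {1, 2, 3}" "j \<in> {1, 2, 3}" "i \<noteq> j"
    and C: "C \<in> dart_components G (kempe_darts G c i j)"
  shows "C \<in> arc_curves G \<union> loop_curves G"
proof (rule balanced_component_curve[OF finite_kempe_darts _ _ _ _ _ _ C])
  let ?D = "kempe_darts G c i j"
  show "fst ` ?D \<subseteq> arcs G" by auto
  show "inj_on (dart_tail G) ?D"
    using source_sink source_sink' tait_inj[OF c] by (intro inj_onI) (auto split: if_splits)
  show "inj_on (dart_head G) ?D"
    using source_sink source_sink' tait_inj[OF c] by (intro inj_onI) (auto split: if_splits)
  show "inj_on fst ?D"
    using ij by (auto intro!: inj_onI split: if_splits)
  show "\<exists>d'\<in>?D. dart_tail G d' = dart_head G d"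
    if d: "d \<in> ?D" "dart_head G d \<notin> boundary_axis" for d
  proof (cases d)
    case (Pair e b)
    show ?thesis
    proof (cases b)
      case True
      then obtain e' where "e' \<in> arcs G" "head G e' = head G e" "c e' = j"
        using tait_ex_head[OF c, of e j] d Pair ij by auto
      then show ?thesis using Pair True by (intro bexI[of _ "(e', False)"]) auto
    next
      case False
      then obtain e' where "e' \<in> arcs G" "tail G e' = tail G e" "c e' = i"
        using tait_ex_tail[OF c, of e i] d Pair ij by auto
      then show ?thesis using Pair False by (intro bexI[of _ "(e', True)"]) auto
    qed
  qed
  show "\<exists>d'\<in>?D. dart_head G d' = dart_tail G d"
    if d: "d \<in> ?D" "dart_tail G d \<notin> boundary_axis" for d
  proof (cases d)
    case (Pair e b)
    show ?thesis
    proof (cases b)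
      case True
      then obtain e' where "e' \<in> arcs G" "tail G e' = tail G e" "c e' = j"
        using tait_ex_tail[OF c, of e j] d Pair ij by auto
      then show ?thesis using Pair True by (intro bexI[of _ "(e', False)"]) auto
    next
      case False
      then obtain e' where "e' \<in> arcs G" "head G e' = head G e" "c e' = i"
        using tait_ex_head[OF c, of e i] d Pair ij by auto
      then show ?thesis using Pair False by (intro bexI[of _ "(e', True)"]) auto
    qed
  qed
qed

subsection \<open>Strandings as Tait colorings\<close>

lemma mem_coloring_stranding:
  "(\<exists>\<gamma>. (k, \<gamma>) \<in> coloring_stranding G c \<and> d \<in> \<gamma>) \<longleftrightarrow> k \<in> {1, 2} \<and> d \<in> kempe_darts G c k (Suc k)"
proof -
  have "d \<in> kempe_darts G c k (Suc k) \<longleftrightarrow>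
        (\<exists>\<gamma>\<in>dart_components G (kempe_darts G c k (Suc k)). d \<in> \<gamma>)"
    using Union_dart_components[of G "kempe_darts G c k (Suc k)"] by (metis UnionE UnionI)
  then show ?thesis by (auto simp: coloring_stranding_def)
qed

text \<open>The labels 100, 010, 001 have successive differences (1, 0), (-1, 1), (0, -1): an edge
  of color \<open>k\<close> carries strand color \<open>k\<close> forward and \<open>k - 1\<close>
  backward, as far as these lie in {1, 2}.\<close>

lemma pos_colors_coloring_stranding:
  "e \<in> arcs G \<Longrightarrow> pos_colors (coloring_stranding G c) e = {k \<in> {1, 2}. c e = k}"
  by (auto simp: pos_colors_def mem_coloring_stranding)

lemma neg_colors_coloring_stranding:
  "e \<in> arcs G \<Longrightarrow> neg_colors (coloring_stranding G c) e = {k \<in> {1, 2}. c e = Suc k}"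
  by (auto simp: neg_colors_def mem_coloring_stranding)

lemma colors_coloring_stranding:
  assumes "tait_coloring G c" "e \<in> arcs G"
  shows "colors (coloring_stranding G c) e = (if c e = 1 then {1} else if c e = 2 then {1, 2} else {2})"
proof -
  have "c e = 1 \<or> c e = 2 \<or> c e = 3" using tait_colors[OF assms] by simp
  then show ?thesis
    using assms(2)
    by (elim disjE) (auto simp: colors_def pos_colors_coloring_stranding neg_colors_coloring_stranding)
qed

lemma coroot_sign_coloring_stranding:
  assumes "e \<in> arcs G" "k \<in> {1, 2}"
  shows "coroot_sign (coloring_stranding G c) e k = of_bool (c e = k) - of_bool (c e = Suc k)"
  using assms(2)
  by (simp add: coroot_sign_def pos_colors_coloring_stranding[OF assms(1)]
      neg_colors_coloring_stranding[OF assms(1)])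

lemma Max_colors_coloring_stranding:
  assumes "tait_coloring G c" "e \<in> arcs G"
  shows "Max (colors (coloring_stranding G c) e) \<in> pos_colors (coloring_stranding G c) e \<longleftrightarrow> c e \<noteq> 3"
proof -
  have "c e = 1 \<or> c e = 2 \<or> c e = 3" using tait_colors[OF assms] by simp
  then show ?thesis
    using assms(2)
    by (elim disjE) (simp_all add: colors_coloring_stranding[OF assms] pos_colors_coloring_stranding)
qed

lemma binary_label_coloring_stranding:
  assumes "tait_coloring G c" "e \<in> arcs G" "k \<in> {1..3}"
  shows "binary_label 3 (coloring_stranding G c) e k = of_bool (c e = k)"
proof -
  have k: "k = 1 \<or> k = 2 \<or> k = 3" using assms(3) by auto
  have two: "{2..<3} = {2::nat}" by auto
  have "c e = 1 \<or> c e = 2 \<or> c e = 3" using tait_colors[OF assms(1,2)] by simp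
  then show ?thesis
    using k unfolding binary_label_def Max_colors_coloring_stranding[OF assms(1,2)]
    by (elim disjE) (simp_all add: coroot_sign_coloring_stranding[OF assms(2)]
        atLeastLessThan_1_3[unfolded One_nat_def] two)
qed

lemma valid_coloring_stranding:
  assumes c: "tait_coloring G c"
  shows "valid_stranding 3 G w (coloring_stranding G c)"
proof -
  let ?S = "coloring_stranding G c"
  have "stranding 3 G ?S"
    unfolding stranding_def
  proof (intro conjI allI impI subsetI)
    fix x assume "x \<in> ?S"
    then show "x \<in> {1..<3} \<times> (arc_curves G \<union> loop_curves G)"
      using kempe_component_curve[OF c, of 1 2] kempe_component_curve[OF c, of 2 3]
      by (auto simp: coloring_stranding_def numeral_eq_Suc)
  next
    fix k \<gamma> \<gamma>'
    assume "(k, \<gamma>) \<in> ?S \<and> (k, \<gamma>') \<in> ?S \<and> \<gamma> \<noteq> \<gamma>'"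
    then show "curve_verts G \<gamma> \<inter> curve_verts G \<gamma>' = {}"
      by (auto simp: coloring_stranding_def dest: dart_components_disjoint)
  qed
  moreover have "colors ?S e \<noteq> {} \<and>
        (\<forall>k \<in> colors ?S e. \<forall>k' \<in> colors ?S e.
           k < k' \<and> colors ?S e \<inter> {k<..<k'} = {} \<longrightarrow> coroot_sign ?S e k' = - coroot_sign ?S e k) \<and>
        (\<Sum>k = 1..<3. coroot_sign ?S e k * int k) =
          (if Max (colors ?S e) \<in> pos_colors ?S e then int (w e) else int (w e) - int 3)"
    if e: "e \<in> arcs G" for e
  proof -
    have "c e = 1 \<or> c e = 2 \<or> c e = 3" using tait_colors[OF c e] by simp
    moreover have "w e = 1" using unit e by simp
    ultimately show ?thesis
      unfolding Max_colors_coloring_stranding[OF c e]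
      unfolding colors_coloring_stranding[OF c e] atLeastLessThan_1_3
      by (elim disjE) (simp_all add: coroot_sign_coloring_stranding[OF e])
  qed
  ultimately show ?thesis
    by (auto simp: valid_stranding_def)
qed

lemma strands_coloring_stranding:
  assumes c: "tait_coloring G c" and ij: "i \<in> {1..3}" "j \<in> {1..3}" "i \<noteq> j"
  shows "strands 3 G (coloring_stranding G c) i j = dart_components G (kempe_darts G c i j)"
proof -
  let ?b = "binary_label 3 (coloring_stranding G c)"
  have "(?b e i - ?b e j = 1 \<longleftrightarrow> c e = i) \<and> (?b e i - ?b e j = - 1 \<longleftrightarrow> c e = j)"
    if e: "e \<in> arcs G" for e
    unfolding binary_label_coloring_stranding[OF c e ij(1)] binary_label_coloring_stranding[OF c e ij(2)]
    using ij(3) by (cases "c e = i"; cases "c e = j") simp_all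
  then have "strand_darts 3 G (coloring_stranding G c) i j = kempe_darts G c i j"
    unfolding strand_darts_def kempe_darts_def by blast
  then show ?thesis by (simp add: strands_def)
qed

section \<open>From valid strandings back to colorings\<close>

lemma valid_stranding_curve:
  assumes "valid_stranding 3 G w S" "(k, C) \<in> S"
  shows "k \<in> {1, 2}" "C \<in> arc_curves G \<union> loop_curves G"
  using assms unfolding valid_stranding_def stranding_def atLeastLessThan_1_3 by blast+

lemma valid_stranding_disjoint:
  assumes "valid_stranding 3 G w S" "(k, C) \<in> S" "(k, C') \<in> S" "d \<in> C" "d' \<in> C'"
    "curve_verts G {d} \<inter> curve_verts G {d'} \<noteq> {}"
  shows "C = C'"
proof (rule ccontr)
  assume "C \<noteq> C'"
  then have "curve_verts G C \<inter> curve_verts G C' = {}"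
    using assms by (auto simp: valid_stranding_def stranding_def)
  then show False using assms(4-6) by (auto simp: curve_verts_def)
qed

text \<open>Curves of one color through the same edge share its ends and hence coincide, and a
  single curve uses an edge in one direction only.\<close>

lemma pos_neg_colors_disjoint:
  assumes S: "valid_stranding 3 G w S" and "k \<in> pos_colors S e" shows "k \<notin> neg_colors S e"
proof
  assume "k \<in> neg_colors S e"
  with assms obtain C C' where C: "(k, C) \<in> S" "(k, C') \<in> S" "(e, True) \<in> C" "(e, False) \<in> C'"
    by (auto simp: pos_colors_def neg_colors_def)
  then have "C = C'"
    using valid_stranding_disjoint[OF S C] by (auto simp: curve_verts_dart)
  then show False
    using C inj_onD[OF curve_inj_fst[OF valid_stranding_curve(2)[OF S C(1)]], of "(e, True)" "(e, False)"]
    by simp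
qed

text \<open>The signed sum of colors must be 1 if the largest color is positive and -2 otherwise.
  Among the nonempty sign patterns on {1, 2} only 1, -1 + 2 and -2 comply.\<close>

lemma valid_stranding_edge_cases:
  assumes S: "valid_stranding 3 G w S" and e: "e \<in> arcs G"
  obtains "pos_colors S e = {1}" "neg_colors S e = {}"
    | "pos_colors S e = {2}" "neg_colors S e = {1}"
    | "pos_colors S e = {}" "neg_colors S e = {2}"
proof -
  let ?p = "pos_colors S e" and ?n = "neg_colors S e"
  have sub: "?p \<subseteq> {1, 2}" "?n \<subseteq> {1, 2}"
    using valid_stranding_curve(1)[OF S] by (auto simp: pos_colors_def neg_colors_def)
  have eq: "A = {k \<in> {1, 2}. k \<in> A}" if "A \<subseteq> {1, 2}" for A :: "nat set" using that by auto
  have disj: "1 \<in> ?p \<Longrightarrow> 1 \<notin> ?n" "2 \<in> ?p \<Longrightarrow> 2 \<notin> ?n"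
    using pos_neg_colors_disjoint[OF S] by auto
  have V: "colors S e \<noteq> {}"
    "\<forall>c \<in> colors S e. \<forall>c' \<in> colors S e.
       c < c' \<and> colors S e \<inter> {c<..<c'} = {} \<longrightarrow> coroot_sign S e c' = - coroot_sign S e c"
    "(\<Sum>c \<in> {1, 2}. coroot_sign S e c * int c) = (if Max (colors S e) \<in> ?p then int (w e) else int (w e) - int 3)"
    using S e unfolding valid_stranding_def atLeastLessThan_1_3 by blast+
  have we: "w e = 1" using unit e by simp
  have p: "?p = (if 1 \<in> ?p then {1} else {}) \<union> (if 2 \<in> ?p then {2} else {})"
    and n: "?n = (if 1 \<in> ?n then {1} else {}) \<union> (if 2 \<in> ?n then {2} else {})"
    using sub by auto
  \<comment> \<open>Four truth values determine both sets, which leaves sixteen cases to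
    compute.\<close>
  define p1 p2 n1 n2 where d: "p1 = (1 \<in> ?p)" "p2 = (2 \<in> ?p)" "n1 = (1 \<in> ?n)" "n2 = (2 \<in> ?n)"
  have p': "?p = (if p1 then {1} else {}) \<union> (if p2 then {2} else {})"
    and n': "?n = (if n1 then {1} else {}) \<union> (if n2 then {2} else {})"
    using p n d by simp_all
  have between: "{1<..<2} = ({} :: nat set)" by auto
  have "p1 \<and> \<not> p2 \<and> \<not> n1 \<and> \<not> n2 \<or> \<not> p1 \<and> p2 \<and> n1 \<and> \<not> n2 \<or> \<not> p1 \<and> \<not> p2 \<and> \<not> n1 \<and> n2"
    using V disj unfolding we colors_def coroot_sign_def p' n'
    by (cases p1; cases p2; cases n1; cases n2) (auto simp: between)
  then show thesis
    using that p' n' by auto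
qed

text \<open>Curves of one color are connected and vertex-disjoint, so they are recoverable from the
  mere set of their darts. Hence the darts per color determine a valid stranding.\<close>

lemma valid_stranding_components:
  assumes S: "valid_stranding 3 G w S"
  shows "dart_components G (\<Union>{C. (k, C) \<in> S}) = {C. (k, C) \<in> S}"
proof (rule dart_components_eqI[OF refl])
  fix C C' assume "C \<in> {C. (k, C) \<in> S}" "C' \<in> {C. (k, C) \<in> S}" "C \<noteq> C'"
  then show "curve_verts G C \<inter> curve_verts G C' = {}"
    using S by (auto simp: valid_stranding_def stranding_def)
qed (use valid_stranding_curve(2)[OF S] curve_nonempty curve_connected in blast)+

lemma valid_stranding_inj:
  assumes S: "valid_stranding 3 G w S"
  shows "inj_on (dart_tail G) (\<Union>{C. (k, C) \<in> S})" "inj_on (dart_head G) (\<Union>{C. (k, C) \<in> S})"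
proof -
  have "d = d'" if C: "(k, C) \<in> S" "(k, C') \<in> S" "d \<in> C" "d' \<in> C'"
    and eq: "dart_tail G d = dart_tail G d' \<or> dart_head G d = dart_head G d'" for C C' d d'
  proof -
    have "C = C'" using valid_stranding_disjoint[OF S C] eq by (auto simp: curve_verts_single)
    then show ?thesis
      using C eq curve_inj_head[OF valid_stranding_curve(2)[OF S C(1)]]
        curve_inj_tail[OF valid_stranding_curve(2)[OF S C(1)]] by (auto dest: inj_onD)
  qed
  then show "inj_on (dart_tail G) (\<Union>{C. (k, C) \<in> S})" "inj_on (dart_head G) (\<Union>{C. (k, C) \<in> S})"
    unfolding inj_on_def by blast+
qed

lemma valid_stranding_coloring:
  assumes S: "valid_stranding 3 G w S"
  obtains c where "tait_coloring G c" "S = coloring_stranding G c"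
proof -
  \<comment> \<open>The backward colors alone tell the three edge types apart: none for 100, {1} for
    010, {2} for 001.\<close>
  define c where "c e = (if neg_colors S e = {} then 1 else if neg_colors S e = {1} then 2 else 3 :: nat)" for e
  define D where "D k = \<Union>{C. (k, C) \<in> S}" for k
  have D_eq: "D k = kempe_darts G c k (Suc k)" if k: "k \<in> {1, 2}" for k
  proof (rule set_eqI)
    fix d :: "'e dart"
    obtain e b where d: "d = (e, b)" by force
    have memD: "(e, True) \<in> D k \<longleftrightarrow> k \<in> pos_colors S e" "(e, False) \<in> D k \<longleftrightarrow> k \<in> neg_colors S e"
      by (auto simp: D_def pos_colors_def neg_colors_def)
    have "e \<in> arcs G" if "d \<in> D k"
      using that d valid_stranding_curve(2)[OF S] curve_arcs by (fastforce simp: D_def)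
    moreover have "d \<in> D k \<longleftrightarrow> d \<in> kempe_darts G c k (Suc k)" if e: "e \<in> arcs G"
      using k e d memD by (cases rule: valid_stranding_edge_cases[OF S e]; cases b) (auto simp: c_def)
    ultimately show "d \<in> D k \<longleftrightarrow> d \<in> kempe_darts G c k (Suc k)"
      using d by auto
  qed
  have "S = coloring_stranding G c"
  proof (rule set_eqI)
    fix x :: "nat \<times> 'e dart set"
    obtain k C where x: "x = (k, C)" by force
    have "k \<in> {1, 2} \<Longrightarrow> dart_components G (kempe_darts G c k (Suc k)) = {C. (k, C) \<in> S}"
      using valid_stranding_components[OF S, of k] D_eq[of k] by (simp add: D_def)
    then show "x \<in> S \<longleftrightarrow> x \<in> coloring_stranding G c"
      using valid_stranding_curve(1)[OF S, of k C] by (auto simp: x coloring_stranding_def)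
  qed
  moreover have "tait_coloring G c"
    unfolding tait_coloring_def
  proof (intro conjI ballI inj_onI)
    fix v e e' assume v: "v \<in> verts G" and e: "e \<in> incident G v" "e' \<in> incident G v" "c e = c e'"
    then have arcs: "e \<in> arcs G" "e' \<in> arcs G" by (auto simp: incident_def)
    \<comment> \<open>Edges of colors 1 and 2 are forward darts of \<open>D 1\<close> and
      \<open>D 2\<close>, those of color 3 are backward darts of \<open>D 2\<close>. So two equally
      colored edges at \<open>v\<close> give darts of one \<open>D k\<close> in the same direction,
      with a common tail or a common head.\<close>
    define k where "k = (if c e = 1 then 1 else 2 :: nat)"
    define b where "b = (c e \<noteq> 3)"
    have "k \<in> {1, 2}" "c e = (if b then k else Suc k)"
      by (auto simp: k_def b_def c_def)
    then have "(e, b) \<in> D k" "(e', b) \<in> D k"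
      using arcs e(3) D_eq[of k] by auto
    moreover have "dart_tail G (e, b) = dart_tail G (e', b) \<or> dart_head G (e, b) = dart_head G (e', b)"
      using e arcs source_sink[of e e'] source_sink[of e' e] by (auto simp: incident_def)
    ultimately have "(e, b) = (e', b)"
      using valid_stranding_inj[OF S, of k] unfolding D_def[symmetric] by (metis inj_onD)
    then show "e = e'" by simp
  qed (simp add: c_def)
  ultimately show thesis using that by blast
qed

subsection \<open>Kempe changes\<close>

text \<open>At each vertex closure puts all edges of colors \<open>i\<close> and \<open>j\<close>
  into \<open>U\<close> or none of them, so there the swap is a permutation of colors.\<close>

lemma tait_swap_colors:
  assumes c: "tait_coloring G c" and ij: "i \<in> {1, 2, 3}" "j \<in> {1, 2, 3}"
    and U: "kempe_closed G c i j U"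
  shows "tait_coloring G (swap_colors c i j U)"
  unfolding tait_coloring_def
proof (intro conjI ballI inj_onI)
  fix e assume "e \<in> arcs G"
  then show "swap_colors c i j U e \<in> {1, 2, 3}"
    using tait_colors[OF c] ij by (auto simp: swap_colors_def)
next
  fix v e e' assume v: "v \<in> verts G" and e: "e \<in> incident G v" "e' \<in> incident G v"
    and eq: "swap_colors c i j U e = swap_colors c i j U e'"
  have "e \<in> U \<longleftrightarrow> e' \<in> U" if "c e \<in> {i, j}" "c e' \<in> {i, j}"
    using U e that by (auto simp: kempe_closed_def incident_def)
  moreover have "c x \<in> {i, j}" if "x \<in> U" for x using U that by (auto simp: kempe_closed_def)
  ultimately have "c e = c e'"
    using eq by (auto simp: swap_colors_def split: if_splits)
  then show "e = e'"
    using c v e by (auto simp: tait_coloring_def dest: inj_onD)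
qed

lemma kempe_closed_component:
  assumes C: "C \<in> dart_components G (kempe_darts G c i j)"
  shows "kempe_closed G c i j (fst ` C)"
  unfolding kempe_closed_def
proof (intro conjI ballI impI)
  show "fst ` C \<subseteq> {e \<in> arcs G. c e \<in> {i, j}}"
    using dart_component_subset[OF C] by (auto split: if_splits)
  fix e e' assume e: "e \<in> fst ` C" "e' \<in> arcs G"
    "c e' \<in> {i, j} \<and> {tail G e, head G e} \<inter> {tail G e', head G e'} \<noteq> {}"
  then obtain b where b: "(e, b) \<in> C" by auto
  \<comment> \<open>The color of \<open>e'\<close> dictates its direction: forward for
    \<open>i\<close>, backward for \<open>j\<close>.\<close>
  have "(e', c e' = i) \<in> kempe_darts G c i j" using e by auto
  from dart_component_closed[OF C b this] e show "e' \<in> fst ` C"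
    by (force simp: curve_verts_dart)
qed

lemma component_subset_kempe_closed:
  assumes C: "C \<in> dart_components G (kempe_darts G c i j)"
    and U: "kempe_closed G c i j U" and "fst d \<in> U" "d \<in> C"
  shows "fst ` C \<subseteq> U"
proof -
  have "C \<subseteq> {d. fst d \<in> U}"
  proof (rule dart_component_least[OF C \<open>d \<in> C\<close>])
    fix x y assume "x \<in> {d. fst d \<in> U}" "y \<in> kempe_darts G c i j"
      "curve_verts G {x} \<inter> curve_verts G {y} \<noteq> {}"
    then show "y \<in> {d. fst d \<in> U}"
      using U by (cases x; cases y) (auto simp: kempe_closed_def curve_verts_dart split: if_splits)
  qed (use assms in simp)
  then show ?thesis by auto
qed

text \<open>Adjacency is symmetric, so no edge of \<open>U - V\<close> touches \<open>V\<close> in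
  the colors \<open>i\<close> and \<open>j\<close>, and the swap keeps the set of edges with these
  two colors.\<close>

lemma kempe_closed_Diff:
  assumes "kempe_closed G c i j U" "kempe_closed G c i j V"
  shows "kempe_closed G (swap_colors c i j V) i j (U - V)"
proof -
  have *: "swap_colors c i j V e \<in> {i, j} \<longleftrightarrow> c e \<in> {i, j}" for e
    by (auto simp: swap_colors_def)
  show ?thesis
    using assms unfolding kempe_closed_def * by blast
qed

lemma strand_reversal_swap:
  assumes c: "tait_coloring G c" and ij: "1 \<le> i" "i < j" "j \<le> 3"
    and C: "C \<in> dart_components G (kempe_darts G c i j)"
  shows "strand_reversal 3 G w (coloring_stranding G c)
           (coloring_stranding G (swap_colors c i j (fst ` C)))"
proof -
  have ij': "i \<in> {1, 2, 3}" "j \<in> {1, 2, 3}" "i \<noteq> j" "i \<in> {1..3}" "j \<in> {1..3}" using ij by auto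
  let ?c = "swap_colors c i j (fst ` C)"
  have c': "tait_coloring G ?c"
    using tait_swap_colors[OF c ij'(1,2) kempe_closed_component[OF C]] .
  have "C \<in> strands 3 G (coloring_stranding G c) i j"
    using C strands_coloring_stranding[OF c ij'(4,5,3)] by simp
  moreover have "binary_label 3 (coloring_stranding G ?c) e k =
          (if e \<in> fst ` C
           then ((binary_label 3 (coloring_stranding G c) e)
                  (i := binary_label 3 (coloring_stranding G c) e j,
                   j := binary_label 3 (coloring_stranding G c) e i)) k
           else binary_label 3 (coloring_stranding G c) e k)"
    if e: "e \<in> arcs G" "k \<in> {1..3}" for e k
    unfolding fun_upd_def binary_label_coloring_stranding[OF c e]
      binary_label_coloring_stranding[OF c' e] binary_label_coloring_stranding[OF c e(1) ij'(4)]
      binary_label_coloring_stranding[OF c e(1) ij'(5)]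
    using ij'(3) by (auto simp: swap_colors_def)
  ultimately have "reverses_strand 3 G w i j C (coloring_stranding G c) (coloring_stranding G ?c)"
    using valid_coloring_stranding[OF c] valid_coloring_stranding[OF c']
    by (simp add: reverses_strand_def)
  then show ?thesis using ij unfolding strand_reversal_def by blast
qed

text \<open>The strands that make up \<open>U\<close> are reversed one at a time; the remaining ones
  stay a closed set for the new coloring.\<close>

lemma strand_reversals_swap:
  assumes "tait_coloring G c" and ij: "1 \<le> i" "i < j" "j \<le> 3" and "kempe_closed G c i j U"
  shows "(strand_reversal 3 G w)\<^sup>*\<^sup>* (coloring_stranding G c)
           (coloring_stranding G (swap_colors c i j U))"
proof -
  have "finite U" using assms(5) finite_arcs by (auto simp: kempe_closed_def intro: finite_subset)
  then show ?thesis
    using assms(1,5)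
  proof (induction U arbitrary: c rule: finite_psubset_induct)
    case (psubset U)
    show ?case
    proof (cases "U = {}")
      case True
      then have "swap_colors c i j U = c" by (auto simp: swap_colors_def)
      then show ?thesis by simp
    next
      case False
      then obtain e where e: "e \<in> U" by blast
      then have "(e, c e = i) \<in> kempe_darts G c i j"
        using psubset.prems(2) by (auto simp: kempe_closed_def)
      then obtain C where C: "C \<in> dart_components G (kempe_darts G c i j)" "(e, c e = i) \<in> C"
        by (rule dart_components_cover)
      let ?V = "fst ` C"
      let ?c = "swap_colors c i j ?V"
      have V: "?V \<subseteq> U"
        using component_subset_kempe_closed[OF C(1) psubset.prems(2) _ C(2)] e by simp
      have "e \<in> ?V" using C(2) by force
      then have "U - ?V \<subset> U" using e by blast
      moreover have "i \<in> {1, 2, 3}" "j \<in> {1, 2, 3}" using ij by auto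
      then have "tait_coloring G ?c"
        using tait_swap_colors[OF psubset.prems(1) _ _ kempe_closed_component[OF C(1)]] by blast
      moreover have "kempe_closed G ?c i j (U - ?V)"
        using kempe_closed_Diff[OF psubset.prems(2) kempe_closed_component[OF C(1)]] .
      ultimately have "(strand_reversal 3 G w)\<^sup>*\<^sup>* (coloring_stranding G ?c)
           (coloring_stranding G (swap_colors ?c i j (U - ?V)))"
        by (rule psubset.IH)
      moreover have "swap_colors ?c i j (U - ?V) = swap_colors c i j U"
        using V by (auto simp: swap_colors_def fun_eq_iff)
      ultimately show ?thesis
        using strand_reversal_swap[OF psubset.prems(1) ij C(1)]
        by (simp add: converse_rtranclp_into_rtranclp)
    qed
  qed
qed

end

subsection \<open>Curves as closed paths in the plane\<close>

definition lower :: "complex set" where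
  "lower = {z. Im z \<le> 0}"

lemma convex_lower: "convex lower"
proof -
  have "lower = {z. \<i> \<bullet> z \<le> 0}" by (auto simp: lower_def inner_complex_def)
  then show ?thesis using convex_halfspace_le[of \<i> 0] by simp
qed

lemma i_notin_lower: "\<i> \<notin> lower"
  by (simp add: lower_def)

definition dart_path :: "('e \<Rightarrow> real \<Rightarrow> complex) \<Rightarrow> 'e dart \<Rightarrow> real \<Rightarrow> complex" where
  "dart_path \<phi> d = (if snd d then \<phi> (fst d) else reversepath (\<phi> (fst d)))"

fun walk_path :: "('e \<Rightarrow> real \<Rightarrow> complex) \<Rightarrow> 'e dart list \<Rightarrow> real \<Rightarrow> complex" where
  "walk_path \<phi> [d] = dart_path \<phi> d"
| "walk_path \<phi> (d # d' # p) = dart_path \<phi> d +++ walk_path \<phi> (d' # p)"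

lemma walk_path_Cons: "p \<noteq> [] \<Longrightarrow> walk_path \<phi> (d # p) = dart_path \<phi> d +++ walk_path \<phi> p"
  by (cases p) auto

lemma dart_ends: "{tail G (fst d), head G (fst d)} = {dart_tail G d, dart_head G d}"
  by (cases d) auto

definition curve_image :: "('e \<Rightarrow> real \<Rightarrow> complex) \<Rightarrow> 'e dart set \<Rightarrow> complex set" where
  "curve_image \<phi> C = (\<Union>d\<in>C. path_image (\<phi> (fst d)))"

text \<open>
  Arcs are closed up by segments from the boundary vertices to \<open>\<i>\<close>; \<open>cap\<close> is the contribution of
  such a segment.
\<close>
definition cap :: "complex \<Rightarrow> complex \<Rightarrow> complex" where
  "cap v z = (if v \<in> boundary_axis then winding_number (linepath \<i> v) z else 0)"

text \<open>For real \<open>b\<close> the height \<open>Im x\<close> is itself the coordinate along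
  the segment, so everything is read off from it.\<close>

lemma segment_from_i:
  assumes "x \<in> closed_segment \<i> b" "b \<in> boundary_axis"
  shows "0 \<le> Im x" "Im x = 0 \<Longrightarrow> x = b" "x = of_real (Im x) * \<i> + of_real (1 - Im x) * b"
proof -
  obtain u where u: "0 \<le> u" "u \<le> 1" "x = (1 - u) *\<^sub>R \<i> + u *\<^sub>R b"
    using assms by (auto simp: closed_segment_def)
  then have Im: "Im x = 1 - u" using assms(2) by (simp add: boundary_axis_def)
  show x: "x = of_real (Im x) * \<i> + of_real (1 - Im x) * b"
    unfolding Im using u(3) by (simp add: scaleR_conv_of_real)
  show "0 \<le> Im x" unfolding Im using u(2) by simp
  show "x = b" if "Im x = 0" using x that by simp
qed

lemma segments_from_i_Int:
  assumes "x \<in> closed_segment \<i> b" "x \<in> closed_segment \<i> b'" "b \<in> boundary_axis" "b' \<in> boundary_axis"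
    "b \<noteq> b'"
  shows "x = \<i>"
proof -
  have "of_real (1 - Im x) * b = of_real (1 - Im x) * b'"
    using segment_from_i(3)[OF assms(1,3)] segment_from_i(3)[OF assms(2,4)] by (metis add_left_cancel)
  then have "Im x = 1" using assms(5) by simp
  then show ?thesis using segment_from_i(3)[OF assms(1,3)] by simp
qed

lemma notin_segment_from_i:
  "z \<in> lower \<Longrightarrow> b \<in> boundary_axis \<Longrightarrow> z \<noteq> b \<Longrightarrow> z \<notin> closed_segment \<i> b"
  using segment_from_i[of z b] by (auto simp: lower_def)

context unit_sl3_web
begin

definition graph_image :: "complex set" where
  "graph_image = (\<Union>e\<in>arcs G. path_image (\<phi> e))"

text \<open>The caps are attached to edges so that they telescope along walks: the weights of an arc
  add up to the winding number of the arc closed through \<i>.\<close>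

definition edge_weight :: "'e \<Rightarrow> complex \<Rightarrow> complex" where
  "edge_weight e z = winding_number (\<phi> e) z + cap (tail G e) z - cap (head G e) z"

definition dart_weight :: "'e dart \<Rightarrow> complex \<Rightarrow> complex" where
  "dart_weight d z = (if snd d then edge_weight (fst d) z else - edge_weight (fst d) z)"

lemma edge_path:
  assumes "e \<in> arcs G"
  shows "pathstart (\<phi> e) = tail G e" "pathfinish (\<phi> e) = head G e"
    and arc_edge: "arc (\<phi> e)" and path_edge: "path (\<phi> e)"
    and edge_interior: "\<phi> e ` {0<..<1} \<subseteq> {z. Im z < 0} - verts G"
    and path_image_edge: "path_image (\<phi> e) = \<phi> e ` {0<..<1} \<union> {tail G e, head G e}"
proof -
  show 1: "pathstart (\<phi> e) = tail G e" "pathfinish (\<phi> e) = head G e"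
    and "\<phi> e ` {0<..<1} \<subseteq> {z. Im z < 0} - verts G"
    using half_plane assms by (auto simp: half_plane_graph_def)
  have "simple_path (\<phi> e)"
    using half_plane assms by (auto simp: half_plane_graph_def)
  then show "arc (\<phi> e)"
    using 1 tail_neq_head[OF assms] by (simp add: arc_simple_path)
  then show "path (\<phi> e)" by (rule arc_imp_path)
  have "{0..1} = {0<..<1} \<union> {0, 1::real}" by auto
  then show "path_image (\<phi> e) = \<phi> e ` {0<..<1} \<union> {tail G e, head G e}"
    using 1 by (simp add: path_image_def pathstart_def pathfinish_def image_Un)
qed

lemma Im_vert: "v \<in> verts G \<Longrightarrow> Im v \<le> 0"
  using half_plane by (auto simp: half_plane_graph_def)

lemma edge_subset_lower: "e \<in> arcs G \<Longrightarrow> path_image (\<phi> e) \<subseteq> lower"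
  using edge_interior[of e] Im_vert[of "tail G e"] Im_vert[of "head G e"]
  by (auto simp: path_image_edge lower_def)

lemma edges_Int:
  assumes "e \<in> arcs G" "e' \<in> arcs G" "e \<noteq> e'" "x \<in> path_image (\<phi> e)" "x \<in> path_image (\<phi> e')"
  shows "x \<in> {tail G e, head G e} \<and> x \<in> {tail G e', head G e'}"
proof -
  have "\<phi> e ` {0<..<1} \<inter> \<phi> e' ` {0<..<1} = {}"
    using half_plane assms by (auto simp: half_plane_graph_def)
  moreover have "{tail G e, head G e, tail G e', head G e'} \<subseteq> verts G" using assms by auto
  ultimately show ?thesis
    using edge_interior[OF assms(1)] edge_interior[OF assms(2)] assms(4,5)
    unfolding path_image_edge[OF assms(1)] path_image_edge[OF assms(2)] by blast
qed

lemma dart_path: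
  assumes "fst d \<in> arcs G"
  shows "arc (dart_path \<phi> d)" "pathstart (dart_path \<phi> d) = dart_tail G d"
    "pathfinish (dart_path \<phi> d) = dart_head G d" "path_image (dart_path \<phi> d) = path_image (\<phi> (fst d))"
proof -
  obtain e b where d: "d = (e, b)" by force
  then show "arc (dart_path \<phi> d)" "pathstart (dart_path \<phi> d) = dart_tail G d"
    "pathfinish (dart_path \<phi> d) = dart_head G d" "path_image (dart_path \<phi> d) = path_image (\<phi> (fst d))"
    using arc_edge[of e] edge_path(1,2)[of e] assms by (simp_all add: dart_path_def arc_reversepath)
qed

lemma winding_number_dart_path:
  assumes "fst d \<in> arcs G" "z \<notin> path_image (\<phi> (fst d))"
  shows "winding_number (dart_path \<phi> d) z =
    dart_weight d z - (cap (dart_tail G d) z - cap (dart_head G d) z)"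
proof -
  obtain e b where d: "d = (e, b)" by force
  then show ?thesis
    using winding_number_reversepath[OF path_edge[OF assms(1)] assms(2)]
    by (cases b) (simp_all add: dart_path_def dart_weight_def edge_weight_def)
qed

text \<open>All conclusions are proved in one induction, because joining a dart to the remaining
  path needs its endpoints, its image and its injectivity together.\<close>

lemma walk_path:
  assumes "dart_walk G p" "distinct (dart_tail G (hd p) # map (dart_head G) p)"
  shows "arc (walk_path \<phi> p)" "pathstart (walk_path \<phi> p) = dart_tail G (hd p)"
    "pathfinish (walk_path \<phi> p) = dart_head G (last p)"
    "path_image (walk_path \<phi> p) = curve_image \<phi> (set p)"
    "z \<notin> curve_image \<phi> (set p) \<Longrightarrow> winding_number (walk_path \<phi> p) z =
       (\<Sum>d\<leftarrow>p. dart_weight d z) - (cap (dart_tail G (hd p)) z - cap (dart_head G (last p)) z)"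
proof -
  have "arc (walk_path \<phi> p) \<and> pathstart (walk_path \<phi> p) = dart_tail G (hd p) \<and>
    pathfinish (walk_path \<phi> p) = dart_head G (last p) \<and>
    path_image (walk_path \<phi> p) = curve_image \<phi> (set p) \<and>
    (z \<notin> curve_image \<phi> (set p) \<longrightarrow> winding_number (walk_path \<phi> p) z =
       (\<Sum>d\<leftarrow>p. dart_weight d z) - (cap (dart_tail G (hd p)) z - cap (dart_head G (last p)) z))"
    using assms
  proof (induction p)
    case (Cons d p)
    have d: "fst d \<in> arcs G" using Cons.prems by (simp add: dart_walk_Cons)
    show ?case
    proof (cases "p = []")
      case True
      then show ?thesis
        using dart_path[OF d] winding_number_dart_path[OF d] by (auto simp: curve_image_def)
    next
      case False
      have p: "dart_walk G p" "dart_head G d = dart_tail G (hd p)"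
        "distinct (dart_tail G (hd p) # map (dart_head G) p)"
        using Cons.prems False by (auto simp: dart_walk_Cons)
      note IH = Cons.IH[OF p(1,3)]
      \<comment> \<open>The tail of \<open>d\<close> is no vertex of the rest, and different edges
        meet only in common end vertices; what remains is the joint.\<close>
      have sub: "path_image (\<phi> (fst d)) \<inter> curve_image \<phi> (set p) \<subseteq> {dart_tail G (hd p)}"
      proof
        fix x assume x: "x \<in> path_image (\<phi> (fst d)) \<inter> curve_image \<phi> (set p)"
        then obtain d' where d': "d' \<in> set p" "x \<in> path_image (\<phi> (fst d'))"
          by (auto simp: curve_image_def)
        have "dart_tail G d' \<in> set (dart_tail G (hd p) # map (dart_head G) p)"
          using dart_walk_tails[OF p(1)] d'(1)
          by (metis imageI in_set_butlastD list.set_map set_ConsD list.set_intros)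
        then have t: "dart_tail G d \<notin> {dart_tail G d', dart_head G d'}"
          using Cons.prems(2) d'(1) p(2) by fastforce
        note ends = dart_ends[of G d] dart_ends[of G d']
        with t have "fst d \<noteq> fst d'" by (metis insertI1)
        moreover have "fst d' \<in> arcs G" using p(1) d'(1) by (auto simp: dart_walk_def)
        ultimately have "x \<in> {dart_tail G d, dart_head G d} \<and> x \<in> {dart_tail G d', dart_head G d'}"
          using edges_Int[OF d, of "fst d'" x] x d'(2) ends by blast
        then show "x \<in> {dart_tail G (hd p)}" using t p(2) by auto
      qed
      have "arc (walk_path \<phi> (d # p))"
        unfolding walk_path_Cons[OF False]
        by (rule arc_join) (use IH dart_path[OF d] sub p(2) in auto)
      moreover have img: "path_image (walk_path \<phi> (d # p)) = curve_image \<phi> (set (d # p))"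
        unfolding walk_path_Cons[OF False]
        by (subst path_image_join) (use IH dart_path[OF d] p(2) in \<open>auto simp: curve_image_def\<close>)
      moreover have "winding_number (walk_path \<phi> (d # p)) z =
          (\<Sum>d\<leftarrow>d # p. dart_weight d z) - (cap (dart_tail G d) z - cap (dart_head G (last p)) z)"
        if "z \<notin> curve_image \<phi> (set (d # p))"
      proof -
        have z: "z \<notin> path_image (\<phi> (fst d))" "z \<notin> curve_image \<phi> (set p)"
          using that by (auto simp: curve_image_def)
        have "winding_number (walk_path \<phi> (d # p)) z =
              winding_number (dart_path \<phi> d) z + winding_number (walk_path \<phi> p) z"
          unfolding walk_path_Cons[OF False]
          by (rule winding_number_join) (use IH dart_path[OF d] p(2) z arc_imp_path in auto)
        then show ?thesis
          using IH z p(2) by (simp add: winding_number_dart_path[OF d z(1)])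
      qed
      ultimately show ?thesis
        using False IH dart_path[OF d] by (simp add: walk_path_Cons)
    qed
  qed simp
  then show "arc (walk_path \<phi> p)" "pathstart (walk_path \<phi> p) = dart_tail G (hd p)"
    "pathfinish (walk_path \<phi> p) = dart_head G (last p)"
    "path_image (walk_path \<phi> p) = curve_image \<phi> (set p)"
    "z \<notin> curve_image \<phi> (set p) \<Longrightarrow> winding_number (walk_path \<phi> p) z =
       (\<Sum>d\<leftarrow>p. dart_weight d z) - (cap (dart_tail G (hd p)) z - cap (dart_head G (last p)) z)"
    by auto
qed

text \<open>The two segments through \<i> meet the lower half-plane only at the ends of the arc, so
  closing it up keeps it simple. Their winding numbers are exactly the caps left over by
  telescoping.\<close>

lemma arc_curve_closed_path:
  assumes "C \<in> arc_curves G"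
  obtains g where "simple_path g" "pathfinish g = pathstart g" "path_image g \<inter> lower = curve_image \<phi> C"
    "connected (curve_image \<phi> C)"
    "\<And>z. z \<in> lower \<Longrightarrow> z \<notin> curve_image \<phi> C \<Longrightarrow> (\<Sum>d\<in>C. dart_weight d z) = winding_number g z"
proof -
  from assms obtain p where C: "C = set p" and p: "dart_walk G p"
    "distinct (dart_tail G (hd p) # map (dart_head G) p)"
    and b: "dart_tail G (hd p) \<in> boundary_axis" "dart_head G (last p) \<in> boundary_axis"
    by (auto simp: arc_curves_def)
  let ?b1 = "dart_tail G (hd p)" and ?b2 = "dart_head G (last p)"
  have "p \<noteq> []" using p by auto
  then have b12: "?b1 \<noteq> ?b2" using p(2) by auto
  have i: "\<i> \<noteq> ?b1" "\<i> \<noteq> ?b2" using b by (auto simp: boundary_axis_def)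
  note W = walk_path[OF p]
  let ?h = "linepath ?b2 \<i> +++ linepath \<i> ?b1"
  let ?g = "walk_path \<phi> p +++ ?h"
  have arc_h: "arc ?h"
    by (rule arc_join)
      (use i segments_from_i_Int[OF _ _ b] b12 in \<open>auto simp: closed_segment_commute\<close>)
  have img_h: "path_image ?h = closed_segment \<i> ?b2 \<union> closed_segment \<i> ?b1"
    by (simp add: path_image_join closed_segment_commute)
  have sub: "curve_image \<phi> C \<subseteq> lower"
    using p(1) edge_subset_lower by (fastforce simp: C curve_image_def dart_walk_def)
  have ends: "?b1 \<in> curve_image \<phi> C" "?b2 \<in> curve_image \<phi> C"
    using W(2-4) pathstart_in_path_image[of "walk_path \<phi> p"] pathfinish_in_path_image[of "walk_path \<phi> p"]
    by (simp_all add: C)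
  have h_lower: "path_image ?h \<inter> lower \<subseteq> {?b1, ?b2}"
    using notin_segment_from_i b unfolding img_h by blast
  have simple: "simple_path ?g"
    by (rule simple_path_join_loop)
      (use W(1-4) arc_h h_lower sub in \<open>auto simp: C\<close>)
  have img: "path_image ?g = curve_image \<phi> C \<union> path_image ?h"
    by (subst path_image_join) (use W(3,4) in \<open>auto simp: C\<close>)
  have 1: "path_image ?g \<inter> lower = curve_image \<phi> C"
    unfolding img using sub h_lower ends by blast
  have 2: "(\<Sum>d\<in>C. dart_weight d z) = winding_number ?g z"
    if z: "z \<in> lower" "z \<notin> curve_image \<phi> C" for z
  proof -
    have nz: "z \<notin> closed_segment \<i> ?b1" "z \<notin> closed_segment \<i> ?b2"
      using notin_segment_from_i z b ends by metis+
    have "winding_number ?g z = winding_number (walk_path \<phi> p) z + winding_number ?h z"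
      by (rule winding_number_join)
        (use W(1-4) arc_h z nz img_h in \<open>auto simp: C arc_imp_path\<close>)
    moreover have "winding_number ?h z = winding_number (linepath ?b2 \<i>) z + winding_number (linepath \<i> ?b1) z"
      by (rule winding_number_join) (use nz in \<open>auto simp: closed_segment_commute\<close>)
    moreover have "winding_number (linepath ?b2 \<i>) z = - winding_number (linepath \<i> ?b2) z"
      using winding_number_reversepath[of "linepath \<i> ?b2" z] nz by simp
    moreover have "(\<Sum>d\<in>C. dart_weight d z) = (\<Sum>d\<leftarrow>p. dart_weight d z)"
      using p(2) by (simp add: C sum_list_distinct_conv_sum_set distinct_map)
    ultimately show ?thesis
      using W(5)[of z] z b by (simp add: C cap_def)
  qed
  have "connected (curve_image \<phi> C)"
    using connected_path_image[OF arc_imp_path[OF W(1)]] W(4) by (simp add: C)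
  then show thesis
    using that[OF simple _ 1 _ 2] W(2) by simp
qed

text \<open>Cutting off the leading dart leaves an arc between its ends, to which
  \<open>walk_path\<close> applies; the two leftover differences of caps cancel.\<close>

lemma loop_curve_closed_path:
  assumes "C \<in> loop_curves G"
  obtains g where "simple_path g" "pathfinish g = pathstart g" "path_image g \<inter> lower = curve_image \<phi> C"
    "connected (curve_image \<phi> C)"
    "\<And>z. z \<in> lower \<Longrightarrow> z \<notin> curve_image \<phi> C \<Longrightarrow> (\<Sum>d\<in>C. dart_weight d z) = winding_number g z"
proof -
  from assms obtain p where C: "C = set p" and p: "dart_walk G p"
    "dart_head G (last p) = dart_tail G (hd p)" "distinct (map (dart_head G) p)" "distinct (map fst p)"
    by (auto simp: loop_curves_def)
  obtain d q where dq: "p = d # q" using p(1) by (cases p) auto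
  have d: "fst d \<in> arcs G" using p(1) dq by (simp add: dart_walk_Cons)
  have "dart_head G d \<noteq> dart_tail G d" using tail_neq_head[OF d] by (cases d) auto
  then have "q \<noteq> []" using p(2) dq by auto
  then have q: "dart_walk G q" "distinct (dart_tail G (hd q) # map (dart_head G) q)"
    "dart_head G d = dart_tail G (hd q)" "dart_head G (last q) = dart_tail G d" "fst d \<notin> fst ` set q"
    using p dq by (auto simp: dart_walk_Cons)
  note W = walk_path[OF q(1,2)]
  let ?g = "dart_path \<phi> d +++ walk_path \<phi> q"
  have sub: "path_image (\<phi> (fst d)) \<inter> curve_image \<phi> (set q) \<subseteq> {dart_tail G d, dart_head G d}"
  proof
    fix x assume x: "x \<in> path_image (\<phi> (fst d)) \<inter> curve_image \<phi> (set q)"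
    then obtain d' where d': "d' \<in> set q" "x \<in> path_image (\<phi> (fst d'))"
      by (auto simp: curve_image_def)
    have "fst d' \<in> arcs G" "fst d \<noteq> fst d'" using q(1,5) d'(1) by (auto simp: dart_walk_def)
    then have "x \<in> {tail G (fst d), head G (fst d)}"
      using edges_Int[OF d, of "fst d'" x] x d'(2) by blast
    then show "x \<in> {dart_tail G d, dart_head G d}" by (cases d) (auto split: if_splits)
  qed
  have simple: "simple_path ?g"
    by (rule simple_path_join_loop) (use W(1-4) dart_path[OF d] sub q in auto)
  have img: "path_image ?g = curve_image \<phi> C"
    by (subst path_image_join) (use W(2,4) dart_path[OF d] q in \<open>auto simp: C dq curve_image_def\<close>)
  have "curve_image \<phi> C \<subseteq> lower"
    using p(1) edge_subset_lower by (fastforce simp: C curve_image_def dart_walk_def)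
  then have 1: "path_image ?g \<inter> lower = curve_image \<phi> C" using img by blast
  have 2: "(\<Sum>d\<in>C. dart_weight d z) = winding_number ?g z"
    if z: "z \<notin> curve_image \<phi> C" for z
  proof -
    have nz: "z \<notin> path_image (\<phi> (fst d))" "z \<notin> curve_image \<phi> (set q)"
      using z by (auto simp: C dq curve_image_def)
    have "winding_number ?g z = winding_number (dart_path \<phi> d) z + winding_number (walk_path \<phi> q) z"
      by (rule winding_number_join) (use W(1-4) dart_path[OF d] q nz in \<open>auto simp: arc_imp_path\<close>)
    moreover have "(\<Sum>d\<in>C. dart_weight d z) = (\<Sum>d\<leftarrow>p. dart_weight d z)"
      using p(3) by (simp add: C sum_list_distinct_conv_sum_set distinct_map)
    ultimately show ?thesis
      using W(5)[OF nz(2)] winding_number_dart_path[OF d nz(1)] q(3,4) by (simp add: dq)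
  qed
  have "connected (curve_image \<phi> C)"
    using connected_path_image[OF simple_path_imp_path[OF simple]] img by simp
  then show thesis
    using that[OF simple _ 1 _ 2] W(3) dart_path(2)[OF d] q(4) by simp
qed

lemma curve_closed_path:
  assumes "C \<in> arc_curves G \<union> loop_curves G"
  obtains g where "simple_path g" "pathfinish g = pathstart g" "path_image g \<inter> lower = curve_image \<phi> C"
    "connected (curve_image \<phi> C)"
    "\<And>z. z \<in> lower \<Longrightarrow> z \<notin> curve_image \<phi> C \<Longrightarrow> (\<Sum>d\<in>C. dart_weight d z) = winding_number g z"
proof (cases "C \<in> arc_curves G")
  case True
  show thesis by (rule arc_curve_closed_path[OF True]) (rule that)
next
  case False
  then have "C \<in> loop_curves G" using assms by blast
  then show thesis by (rule loop_curve_closed_path) (rule that)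
qed

subsection \<open>Winding numbers of strands\<close>

text \<open>
  With the value 0 on the curve itself, \<open>wind C\<close> takes the same two values on the curve as next to it.
\<close>
definition wind :: "'e dart set \<Rightarrow> complex \<Rightarrow> int" where
  "wind C z = (if z \<in> curve_image \<phi> C then 0 else \<lfloor>Re (\<Sum>d\<in>C. dart_weight d z)\<rfloor>)"

lemma curve_image_subset:
  assumes "C \<in> arc_curves G \<union> loop_curves G"
  shows "curve_image \<phi> C \<subseteq> lower" "closed (curve_image \<phi> C)" "connected (curve_image \<phi> C)"
proof -
  obtain g where g: "simple_path g" "path_image g \<inter> lower = curve_image \<phi> C"
    "connected (curve_image \<phi> C)"
    using curve_closed_path[OF assms] by metis
  have "closed (path_image g)"
    using g(1) by (simp add: closed_path_image simple_path_imp_path)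
  moreover have "closed lower"
    unfolding lower_def by (intro closed_Collect_le continuous_intros)
  ultimately show "curve_image \<phi> C \<subseteq> lower" "closed (curve_image \<phi> C)" "connected (curve_image \<phi> C)"
    using g(2,3) by (auto simp flip: g(2))
qed

text \<open>The Jordan curve theorem: the closed path winds 0 times around outside points and once,
  with a fixed sign, around inside points. The properties are bundled because they share this sign
  and this path; \<open>wind C\<close> agrees with its winding number only in \<open>lower\<close>
  off the curve.\<close>

lemma curve_winding:
  assumes C: "C \<in> arc_curves G \<union> loop_curves G"
  obtains t B where "t \<in> {1, -1}" "\<And>z. z \<in> lower \<Longrightarrow> wind C z \<in> {0, t}"
    and "\<And>z. z \<in> lower \<Longrightarrow> z \<notin> curve_image \<phi> C \<Longrightarrow> (\<Sum>d\<in>C. dart_weight d z) = of_int (wind C z)"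
    and "\<And>A. connected A \<Longrightarrow> A \<subseteq> lower \<Longrightarrow> A \<inter> curve_image \<phi> C = {} \<Longrightarrow> wind C constant_on A"
    and "\<And>z. z \<in> lower \<Longrightarrow> B \<le> norm z \<Longrightarrow> wind C z = 0"
    and "\<And>p S. p \<in> curve_image \<phi> C \<Longrightarrow> open S \<Longrightarrow> p \<in> S \<Longrightarrow> S \<subseteq> lower \<Longrightarrow>
           \<exists>z1\<in>S - curve_image \<phi> C. \<exists>z2\<in>S - curve_image \<phi> C. wind C z1 = 0 \<and> wind C z2 = t"
proof -
  obtain g where g: "simple_path g" "pathfinish g = pathstart g"
    "path_image g \<inter> lower = curve_image \<phi> C"
    and wn: "\<And>z. z \<in> lower \<Longrightarrow> z \<notin> curve_image \<phi> C \<Longrightarrow> (\<Sum>d\<in>C. dart_weight d z) = winding_number g z"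
    by (rule curve_closed_path[OF C]) (rule that)
  have path: "path g" using g(1) by (rule simple_path_imp_path)
  obtain t :: int where t: "t \<in> {1, -1}"
    and inside: "\<And>z. z \<in> inside (path_image g) \<Longrightarrow> winding_number g z = of_int t"
    using simple_closed_path_winding_number_inside[OF g(1)]
    by (metis insertCI of_int_1 of_int_minus)
  have outside: "winding_number g z = 0" if "z \<in> outside (path_image g)" for z
    using winding_number_zero_in_outside[OF path g(2) that] .
  have wind: "winding_number g z = of_int (wind C z)" if "z \<in> lower" "z \<notin> curve_image \<phi> C" for z
  proof -
    have "z \<notin> path_image g" using that g(3) by blast
    then obtain n where "winding_number g z = of_int n"
      using integer_winding_number[OF path g(2)] by (auto elim: Ints_cases)
    then show ?thesis using wn[OF that] that(2) by (simp add: wind_def)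
  qed
  have cases: "wind C z \<in> {0, t}" if "z \<in> lower" for z
  proof (cases "z \<in> curve_image \<phi> C")
    case False
    then have "z \<notin> path_image g" using g(3) that by blast
    then consider "z \<in> inside (path_image g)" | "z \<in> outside (path_image g)"
      using inside_Un_outside[of "path_image g"] by blast
    then show ?thesis
    proof cases
      case 1
      then have "complex_of_int (wind C z) = of_int t" using inside wind[OF that False] by metis
      then show ?thesis by simp
    next
      case 2
      then have "complex_of_int (wind C z) = 0" using outside wind[OF that False] by metis
      then show ?thesis by simp
    qed
  qed (simp add: wind_def)
  have const: "wind C constant_on A"
    if A: "connected A" "A \<subseteq> lower" "A \<inter> curve_image \<phi> C = {}" for A
  proof -
    have "A \<inter> path_image g = {}" using A g(3) by blast
    then obtain w where w: "\<And>z. z \<in> A \<Longrightarrow> winding_number g z = w"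
      using winding_number_constant[OF path g(2) A(1)] by (auto simp: constant_on_def)
    have "wind C z = \<lfloor>Re w\<rfloor>" if "z \<in> A" for z
    proof -
      have "z \<in> lower" "z \<notin> curve_image \<phi> C" using A that by auto
      then have "w = of_int (wind C z)" using w[OF that] wind[of z] by simp
      then show ?thesis by simp
    qed
    then show ?thesis unfolding constant_on_def by blast
  qed
  obtain B where B: "\<And>z. B \<le> norm z \<Longrightarrow> winding_number g z = 0"
    using winding_number_zero_at_infinity[OF path g(2)] by blast
  have zero: "wind C z = 0" if "z \<in> lower" "B \<le> norm z" for z
  proof (cases "z \<in> curve_image \<phi> C")
    case False
    then show ?thesis using B[OF that(2)] wind[OF that(1)] by simp
  qed (simp add: wind_def)
  have jump: "\<exists>z1\<in>S - curve_image \<phi> C. \<exists>z2\<in>S - curve_image \<phi> C. wind C z1 = 0 \<and> wind C z2 = t"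
    if p: "p \<in> curve_image \<phi> C" "open S" "p \<in> S" "S \<subseteq> lower" for p S
  proof -
    \<comment> \<open>Every point of a Jordan curve is a boundary point of both sides, so each
      neighbourhood meets both.\<close>
    have "p \<in> frontier (inside (path_image g))" "p \<in> frontier (outside (path_image g))"
      using Jordan_inside_outside[OF g(1,2)] p(1) g(3) by auto
    then have "p \<in> closure (inside (path_image g))" "p \<in> closure (outside (path_image g))"
      by (auto simp: frontier_def)
    then have "S \<inter> inside (path_image g) \<noteq> {}" "S \<inter> outside (path_image g) \<noteq> {}"
      using open_Int_closure_eq_empty[OF p(2)] p(3) by blast+
    then obtain z1 z2 where z: "z1 \<in> S" "z1 \<in> outside (path_image g)" "z2 \<in> S" "z2 \<in> inside (path_image g)"
      by blast
    then have n: "z1 \<notin> curve_image \<phi> C" "z2 \<notin> curve_image \<phi> C"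
      using g(3) outside_no_overlap[of "path_image g"] inside_no_overlap[of "path_image g"] by blast+
    have "z1 \<in> lower" "z2 \<in> lower" using z p(4) by auto
    then have "of_int (wind C z1) = complex_of_int 0" "of_int (wind C z2) = complex_of_int t"
      using wind[of z1] outside[OF z(2)] n wind[of z2] inside[OF z(4)] by simp_all
    then have "wind C z1 = 0" "wind C z2 = t" by (simp_all only: of_int_eq_iff)
    then show ?thesis using z n by blast
  qed
  show thesis
  proof (rule that[of t B])
    show "(\<Sum>d\<in>C. dart_weight d z) = of_int (wind C z)" if "z \<in> lower" "z \<notin> curve_image \<phi> C" for z
      using wn[OF that] wind[OF that] by simp
  qed (fact t cases const zero jump)+
qed

lemma wind_sign:
  assumes "C \<in> arc_curves G \<union> loop_curves G"
  shows "\<exists>t\<in>{1, -1}. \<forall>z\<in>lower. wind C z \<in> {0, t}"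
proof (rule curve_winding[OF assms(1)])
  fix t :: int
  assume "t \<in> {1, -1}" "\<And>z. z \<in> lower \<Longrightarrow> wind C z \<in> {0, t}"
  then show ?thesis by blast
qed

lemma sum_dart_weight:
  assumes "C \<in> arc_curves G \<union> loop_curves G" "z \<in> lower" "z \<notin> curve_image \<phi> C"
  shows "(\<Sum>d\<in>C. dart_weight d z) = of_int (wind C z)"
proof (rule curve_winding[OF assms(1)])
  assume "\<And>z. z \<in> lower \<Longrightarrow> z \<notin> curve_image \<phi> C \<Longrightarrow> (\<Sum>d\<in>C. dart_weight d z) = of_int (wind C z)"
  then show ?thesis using assms(2,3) .
qed

lemma wind_constant_on:
  assumes "C \<in> arc_curves G \<union> loop_curves G" "connected A" "A \<subseteq> lower" "A \<inter> curve_image \<phi> C = {}"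
  shows "wind C constant_on A"
proof (rule curve_winding[OF assms(1)])
  assume "\<And>A. connected A \<Longrightarrow> A \<subseteq> lower \<Longrightarrow> A \<inter> curve_image \<phi> C = {} \<Longrightarrow> wind C constant_on A"
  then show ?thesis using assms(2-4) .
qed

lemma wind_zero_at_infinity:
  assumes "C \<in> arc_curves G \<union> loop_curves G"
  shows "\<exists>B. \<forall>z\<in>lower. B \<le> norm z \<longrightarrow> wind C z = 0"
proof (rule curve_winding[OF assms(1)])
  fix B :: real
  assume "\<And>z. z \<in> lower \<Longrightarrow> B \<le> norm z \<Longrightarrow> wind C z = 0"
  then show ?thesis by blast
qed

lemma wind_jump:
  assumes "C \<in> arc_curves G \<union> loop_curves G" "p \<in> curve_image \<phi> C" "open S" "p \<in> S" "S \<subseteq> lower"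
  obtains z1 z2 where "z1 \<in> S - curve_image \<phi> C" "z2 \<in> S - curve_image \<phi> C" "wind C z1 \<noteq> wind C z2"
proof (rule curve_winding[OF assms(1)])
  fix t :: int
  assume t: "t \<in> {1, -1}"
    and "\<And>p S. p \<in> curve_image \<phi> C \<Longrightarrow> open S \<Longrightarrow> p \<in> S \<Longrightarrow> S \<subseteq> lower \<Longrightarrow>
           \<exists>z1\<in>S - curve_image \<phi> C. \<exists>z2\<in>S - curve_image \<phi> C. wind C z1 = 0 \<and> wind C z2 = t"
  from this(2)[OF assms(2-5)] obtain z1 z2
    where "z1 \<in> S - curve_image \<phi> C" "z2 \<in> S - curve_image \<phi> C" "wind C z1 = 0" "wind C z2 = t"
    by blast
  then show thesis using that[of z1 z2] t by auto
qed

lemma eventually_wind_const: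
  assumes C: "C \<in> arc_curves G \<union> loop_curves G" and p: "p \<in> lower" "p \<notin> curve_image \<phi> C"
  shows "eventually (\<lambda>z. wind C z = wind C p) (at p within lower)"
proof -
  have "open (- curve_image \<phi> C)" using curve_image_subset(2)[OF C] by (simp add: open_Compl)
  then obtain r where r: "r > 0" "ball p r \<subseteq> - curve_image \<phi> C"
    using p(2) by (metis ComplI openE)
  have "convex (ball p r \<inter> lower)"
    by (simp add: convex_Int convex_lower)
  moreover have "ball p r \<inter> lower \<inter> curve_image \<phi> C = {}" using r(2) by blast
  ultimately have "wind C constant_on (ball p r \<inter> lower)"
    by (intro wind_constant_on[OF C]) (auto intro: convex_connected)
  moreover have "p \<in> ball p r \<inter> lower" using p r by simp
  ultimately have "wind C z = wind C p" if "z \<in> lower" "dist z p < r" for z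
    using that by (auto simp: constant_on_def dist_commute)
  then show ?thesis using r(1) by (auto simp: eventually_at)
qed

text \<open>A common point of two edges forces a common end vertex, which different components
  cannot have.\<close>

lemma curve_images_disjoint:
  assumes "tait_coloring G c" and "i \<in> {1, 2, 3}" "j \<in> {1, 2, 3}" "i \<noteq> j"
    and C: "C \<in> dart_components G (kempe_darts G c i j)" "C' \<in> dart_components G (kempe_darts G c i j)"
      "C \<noteq> C'"
  shows "curve_image \<phi> C \<inter> curve_image \<phi> C' = {}"
proof (rule ccontr)
  assume "curve_image \<phi> C \<inter> curve_image \<phi> C' \<noteq> {}"
  then obtain x d d' where d: "d \<in> C" "d' \<in> C'" "x \<in> path_image (\<phi> (fst d))" "x \<in> path_image (\<phi> (fst d'))"
    by (auto simp: curve_image_def)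
  have arcs: "fst d \<in> arcs G" "fst d' \<in> arcs G"
    using d dart_component_subset[OF C(1)] dart_component_subset[OF C(2)]
    by (cases d; cases d'; auto)+
  have "{tail G (fst d), head G (fst d)} \<inter> {tail G (fst d'), head G (fst d')} \<noteq> {}"
    using edges_Int[OF arcs _ d(3,4)] by (cases "fst d = fst d'") auto
  then have "curve_verts G {d} \<inter> curve_verts G {d'} \<noteq> {}"
    unfolding curve_verts_single dart_ends .
  then have "curve_verts G C \<inter> curve_verts G C' \<noteq> {}"
    using d(1,2) by (subst (1 2) curve_verts_eq_UN) blast
  then show False using dart_components_disjoint[OF C] by blast
qed

subsection \<open>Heights\<close>

definition height :: "('e \<Rightarrow> nat) \<Rightarrow> nat \<Rightarrow> complex \<Rightarrow> complex" where
  "height c i z = (\<Sum>e\<in>arcs G. of_bool (c e = i) * edge_weight e z)"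

definition regular :: "complex set" where
  "regular = lower - graph_image"

text \<open>
  Up to integers, \<open>edge_weight\<close> is the coboundary of \<open>vertex_log\<close>; boundary vertices count as \<open>\<i>\<close>.
\<close>
definition vertex_log :: "complex \<Rightarrow> complex \<Rightarrow> complex" where
  "vertex_log v z =
     (if v \<in> boundary_axis then 0 else (Ln (v - z) - Ln (\<i> - z)) / (2 * pi * \<i>))"

text \<open>In a Tait coloring each interior sink is the head, and each interior source the tail, of
  exactly one edge of color \<open>i\<close>. Summing the coboundary over these edges therefore
  gives an expression free of \<open>i\<close> and of the coloring.\<close>

definition base_height :: "complex \<Rightarrow> complex" where
  "base_height z = (\<Sum>v\<in>head G ` arcs G - boundary_axis. vertex_log v z)
                 - (\<Sum>v\<in>tail G ` arcs G - boundary_axis. vertex_log v z)"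

text \<open>For boundary vertices the cap, otherwise the logarithm, supplies the exponent of the
  ratio of \<open>v - z\<close> to \<open>\<i> - z\<close>.\<close>

lemma exp_cap_vertex_log:
  assumes "z \<in> lower" "z \<noteq> v"
  shows "v - z = exp (2 * pi * \<i> * (cap v z + vertex_log v z)) * (\<i> - z)"
proof (cases "v \<in> boundary_axis")
  case True
  have "z \<notin> path_image (linepath \<i> v)"
    using notin_segment_from_i[OF assms(1) True] assms(2) by simp
  from winding_number_exp_2pi[OF _ this] True show ?thesis
    by (simp add: cap_def vertex_log_def)
next
  case False
  have "\<i> \<noteq> z" using assms(1) i_notin_lower by auto
  then show ?thesis
    using False assms(2) by (simp add: cap_def vertex_log_def exp_diff)
qed

text \<open>After exponentiation both quantities describe the ratio of \<open>head G e - z\<close>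
  to \<open>tail G e - z\<close>, so the exponents differ by a multiple of
  \<open>2 * pi * \<i>\<close>.\<close>

lemma edge_weight_mod_int:
  assumes e: "e \<in> arcs G" and z: "z \<in> regular"
  shows "edge_weight e z - (vertex_log (head G e) z - vertex_log (tail G e) z) \<in> \<int>"
proof -
  have z': "z \<in> lower" "z \<notin> path_image (\<phi> e)"
    using z e by (auto simp: regular_def graph_image_def)
  have ne: "z \<noteq> tail G e" "z \<noteq> head G e"
    using z'(2) path_image_edge[OF e] by auto
  have iz: "\<i> - z \<noteq> 0" using z'(1) i_notin_lower by auto
  let ?k = "2 * pi * \<i> :: complex"
  let ?h = "cap (head G e) z + vertex_log (head G e) z" and ?t = "cap (tail G e) z + vertex_log (tail G e) z"
  let ?w = "winding_number (\<phi> e) z"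
  have "head G e - z = exp (?k * ?w) * (tail G e - z)"
    using winding_number_exp_2pi[OF path_edge[OF e] z'(2)] edge_path(1,2)[OF e] by simp
  then have "exp (?k * ?h) * (\<i> - z) = exp (?k * ?w) * (exp (?k * ?t) * (\<i> - z))"
    using exp_cap_vertex_log[OF z'(1) ne(1)] exp_cap_vertex_log[OF z'(1) ne(2)] by metis
  then have "exp (?k * ?h) = exp (?k * (?w + ?t))"
    using iz by (simp add: exp_add distrib_left)
  then obtain n :: int where "?k * ?h = ?k * (?w + ?t) + (of_int (2 * n) * pi) * \<i>"
    by (auto simp: exp_eq)
  then have "?k * ?h = ?k * (?w + ?t + of_int n)" by (simp add: algebra_simps)
  then have "?h = ?w + ?t + of_int n" by simp
  then have "edge_weight e z - (vertex_log (head G e) z - vertex_log (tail G e) z) = of_int (- n)"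
    by (simp add: edge_weight_def algebra_simps)
  then show ?thesis by (metis Ints_of_int)
qed

text \<open>The edges of color \<open>i\<close> hit each interior sink exactly once, and boundary
  vertices contribute 0.\<close>

lemma sum_heads:
  assumes c: "tait_coloring G c" and i: "i \<in> {1, 2, 3}" and f: "\<And>v. v \<in> boundary_axis \<Longrightarrow> f v = (0::complex)"
  shows "(\<Sum>e | e \<in> arcs G \<and> c e = i. f (head G e)) = sum f (head G ` arcs G - boundary_axis)"
proof -
  let ?A = "{e \<in> arcs G. c e = i}"
  have inj: "inj_on (head G) ?A" using tait_inj[OF c] by (auto intro!: inj_onI)
  have "(\<Sum>e\<in>?A. f (head G e)) = sum f (head G ` ?A)"
    by (simp add: sum.reindex[OF inj])
  also have "\<dots> = sum f (head G ` ?A - boundary_axis)"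
    by (rule sum.mono_neutral_right) (auto simp: f)
  also have "head G ` ?A - boundary_axis = head G ` arcs G - boundary_axis"
  proof (intro set_eqI iffI)
    fix v assume "v \<in> head G ` arcs G - boundary_axis"
    then obtain e where "e \<in> arcs G" "v = head G e" "v \<notin> boundary_axis" by blast
    moreover from this obtain e' where "e' \<in> arcs G" "head G e' = head G e" "c e' = i"
      using tait_ex_head[OF c _ _ i, of e] by blast
    ultimately show "v \<in> head G ` ?A - boundary_axis" by (auto intro!: image_eqI[of _ _ e'])
  qed blast
  finally show ?thesis by simp
qed

lemma sum_tails:
  assumes c: "tait_coloring G c" and i: "i \<in> {1, 2, 3}" and f: "\<And>v. v \<in> boundary_axis \<Longrightarrow> f v = (0::complex)"
  shows "(\<Sum>e | e \<in> arcs G \<and> c e = i. f (tail G e)) = sum f (tail G ` arcs G - boundary_axis)"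
proof -
  let ?A = "{e \<in> arcs G. c e = i}"
  have inj: "inj_on (tail G) ?A" using tait_inj[OF c] by (auto intro!: inj_onI)
  have "(\<Sum>e\<in>?A. f (tail G e)) = sum f (tail G ` ?A)"
    by (simp add: sum.reindex[OF inj])
  also have "\<dots> = sum f (tail G ` ?A - boundary_axis)"
    by (rule sum.mono_neutral_right) (auto simp: f)
  also have "tail G ` ?A - boundary_axis = tail G ` arcs G - boundary_axis"
  proof (intro set_eqI iffI)
    fix v assume "v \<in> tail G ` arcs G - boundary_axis"
    then obtain e where "e \<in> arcs G" "v = tail G e" "v \<notin> boundary_axis" by blast
    moreover from this obtain e' where "e' \<in> arcs G" "tail G e' = tail G e" "c e' = i"
      using tait_ex_tail[OF c _ _ i, of e] by blast
    ultimately show "v \<in> tail G ` ?A - boundary_axis" by (auto intro!: image_eqI[of _ _ e'])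
  qed blast
  finally show ?thesis by simp
qed

lemma height_mod_int:
  assumes c: "tait_coloring G c" and i: "i \<in> {1, 2, 3}" and z: "z \<in> regular"
  shows "height c i z - base_height z \<in> \<int>"
proof -
  let ?A = "{e \<in> arcs G. c e = i}"
  have "height c i z = (\<Sum>e\<in>?A. edge_weight e z)"
    unfolding height_def by (rule sum.mono_neutral_cong_right) auto
  moreover have "base_height z = (\<Sum>e\<in>?A. vertex_log (head G e) z - vertex_log (tail G e) z)"
    unfolding base_height_def sum_subtractf
    using sum_heads[OF c i, of "\<lambda>v. vertex_log v z"] sum_tails[OF c i, of "\<lambda>v. vertex_log v z"]
    by (simp add: vertex_log_def)
  ultimately have "height c i z - base_height z =
      (\<Sum>e\<in>?A. edge_weight e z - (vertex_log (head G e) z - vertex_log (tail G e) z))"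
    by (simp add: sum_subtractf)
  also have "\<dots> \<in> \<int>" using edge_weight_mod_int z by (intro Ints_sum) auto
  finally show ?thesis .
qed

text \<open>On \<open>regular\<close> the difference is already an integer for a Tait coloring;
  floor and real part only convert its type.\<close>

definition level :: "('e \<Rightarrow> nat) \<Rightarrow> nat \<Rightarrow> complex \<Rightarrow> int" where
  "level c i z = \<lfloor>Re (height c i z - base_height z)\<rfloor>"

lemma height_eq_level:
  assumes "tait_coloring G c" "i \<in> {1, 2, 3}" "z \<in> regular"
  shows "height c i z = base_height z + of_int (level c i z)"
proof -
  obtain n where "height c i z - base_height z = of_int n"
    using height_mod_int[OF assms] by (auto elim: Ints_cases)
  then show ?thesis by (simp add: level_def algebra_simps)
qed

text \<open>Every edge has one of the three colors, so the three heights together count each edge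
  once.\<close>

lemma sum_level_indep:
  assumes "tait_coloring G c" "tait_coloring G c'" "z \<in> regular"
  shows "level c 1 z + level c 2 z + level c 3 z = level c' 1 z + level c' 2 z + level c' 3 z"
proof -
  have "height c 1 z + height c 2 z + height c 3 z = (\<Sum>e\<in>arcs G. edge_weight e z)"
    if c: "tait_coloring G c" for c
    unfolding height_def sum.distrib[symmetric]
  proof (rule sum.cong[OF refl])
    fix e assume "e \<in> arcs G"
    then have "c e = 1 \<or> c e = 2 \<or> c e = 3" using tait_colors[OF c] by simp
    then show "of_bool (c e = 1) * edge_weight e z + of_bool (c e = 2) * edge_weight e z +
        of_bool (c e = 3) * edge_weight e z = edge_weight e z" by auto
  qed
  then have "height c 1 z + height c 2 z + height c 3 z = height c' 1 z + height c' 2 z + height c' 3 z"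
    using assms by simp
  then have "complex_of_int (level c 1 z + level c 2 z + level c 3 z)
      = of_int (level c' 1 z + level c' 2 z + level c' 3 z)"
    using assms by (simp add: height_eq_level algebra_simps)
  then show ?thesis unfolding of_int_eq_iff .
qed

section \<open>Level differences as sums of winding numbers of strands\<close>

lemma sum_kempe_darts:
  fixes F :: "'e \<Rightarrow> complex"
  assumes "i \<noteq> j"
  shows "(\<Sum>d\<in>kempe_darts G c i j. F (fst d) * dart_weight d z) =
    (\<Sum>e\<in>arcs G. F e * ((of_bool (c e = i) - of_bool (c e = j)) * edge_weight e z))"
proof -
  let ?P = "{e \<in> arcs G. c e = i}" and ?N = "{e \<in> arcs G. c e = j}"
  have D: "kempe_darts G c i j = (\<lambda>e. (e, True)) ` ?P \<union> (\<lambda>e. (e, False)) ` ?N"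
    by (auto simp: kempe_darts_def)
  have "(\<Sum>d\<in>kempe_darts G c i j. F (fst d) * dart_weight d z) =
      (\<Sum>e\<in>?P. F e * edge_weight e z) - (\<Sum>e\<in>?N. F e * edge_weight e z)"
    unfolding D by (subst sum.union_disjoint)
      (auto simp: sum.reindex inj_on_def dart_weight_def sum_negf)
  also have "(\<Sum>e\<in>?P. F e * edge_weight e z) = (\<Sum>e\<in>arcs G. F e * (of_bool (c e = i) * edge_weight e z))"
    by (rule sum.mono_neutral_cong_left) auto
  also have "(\<Sum>e\<in>?N. F e * edge_weight e z) = (\<Sum>e\<in>arcs G. F e * (of_bool (c e = j) * edge_weight e z))"
    by (rule sum.mono_neutral_cong_left) auto
  finally show ?thesis
    by (simp add: algebra_simps flip: sum_subtractf)
qed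

lemma finite_components [simp]: "finite (dart_components G (kempe_darts G c i j))"
  by (simp add: dart_components_altdef)

lemma component_arcs:
  "C \<in> dart_components G (kempe_darts G c i j) \<Longrightarrow> fst ` C \<subseteq> arcs G"
  using dart_component_subset by fastforce

text \<open>\<open>F\<close> gives each strand a coefficient: the constant 1 yields the level
  difference of \<open>c\<close>, and -1 on the strands to be reversed yields the difference after
  the fold.\<close>

lemma sum_over_components:
  assumes c: "tait_coloring G c" and ij: "i \<in> {1, 2, 3}" "j \<in> {1, 2, 3}" "i \<noteq> j"
    and z: "z \<in> regular"
    and F: "\<And>C d. C \<in> dart_components G (kempe_darts G c i j) \<Longrightarrow> d \<in> C \<Longrightarrow> F (fst d) = s C"
  shows "(\<Sum>e\<in>arcs G. of_int (F e) * ((of_bool (c e = i) - of_bool (c e = j)) * edge_weight e z)) =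
    of_int (\<Sum>C\<in>dart_components G (kempe_darts G c i j). s C * wind C z)"
proof -
  let ?D = "kempe_darts G c i j"
  have "(\<Sum>e\<in>arcs G. of_int (F e) * ((of_bool (c e = i) - of_bool (c e = j)) * edge_weight e z)) =
    (\<Sum>d\<in>\<Union>(dart_components G ?D). of_int (F (fst d)) * dart_weight d z)"
    using sum_kempe_darts[OF ij(3), where F = "\<lambda>e. of_int (F e)"] by (simp add: Union_dart_components)
  also have "\<dots> = (\<Sum>C\<in>dart_components G ?D. \<Sum>d\<in>C. of_int (F (fst d)) * dart_weight d z)"
  proof (subst sum.Union_disjoint)
    show "\<forall>C\<in>dart_components G ?D. finite C"
      using dart_component_subset finite_subset finite_kempe_darts by metis
    show "\<forall>A\<in>dart_components G ?D. \<forall>B\<in>dart_components G ?D. A \<noteq> B \<longrightarrow> A \<inter> B = {}"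
      using dart_components_disjoint[of _ G ?D] unfolding curve_verts_def by blast
  qed simp
  also have "\<dots> = (\<Sum>C\<in>dart_components G ?D. of_int (s C * wind C z))"
  proof (rule sum.cong[OF refl])
    fix C assume C: "C \<in> dart_components G ?D"
    have "z \<in> lower" "z \<notin> curve_image \<phi> C"
      using z component_arcs[OF C] by (auto simp: regular_def graph_image_def curve_image_def)
    then have "(\<Sum>d\<in>C. dart_weight d z) = of_int (wind C z)"
      by (rule sum_dart_weight[OF kempe_component_curve[OF c ij C]])
    moreover have "(\<Sum>d\<in>C. of_int (F (fst d)) * dart_weight d z) = of_int (s C) * (\<Sum>d\<in>C. dart_weight d z)"
      using F[OF C] by (simp add: sum_distrib_left)
    ultimately show "(\<Sum>d\<in>C. of_int (F (fst d)) * dart_weight d z) = of_int (s C * wind C z)" by simp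
  qed
  finally show ?thesis by simp
qed

lemma level_diff:
  assumes "tait_coloring G c" and "i \<in> {1, 2, 3}" "j \<in> {1, 2, 3}" "i \<noteq> j" and "z \<in> regular"
  shows "level c i z - level c j z = (\<Sum>C\<in>dart_components G (kempe_darts G c i j). wind C z)"
proof -
  have "complex_of_int (level c i z - level c j z) = height c i z - height c j z"
    using assms by (simp add: height_eq_level)
  also have "\<dots> = (\<Sum>e\<in>arcs G. of_int 1 * ((of_bool (c e = i) - of_bool (c e = j)) * edge_weight e z))"
    unfolding height_def sum_subtractf[symmetric] by (rule sum.cong) (simp_all add: algebra_simps)
  also have "\<dots> = of_int (\<Sum>C\<in>dart_components G (kempe_darts G c i j). 1 * wind C z)"
    by (rule sum_over_components[OF assms]) simp
  finally show ?thesis by (simp only: of_int_eq_iff mult_1)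
qed

end

subsection \<open>Folding\<close>

text \<open>The sums drop by \<open>18 * q * (3 * q + 3 * r - 1)\<close> for the two adjacent pairs
  and by \<open>18 * q * (3 * q + 3 * r - 2)\<close> for the outer pair. With \<open>r\<close> in
  {0, 1} the last factor has the sign of \<open>q\<close>, so the drop is positive.\<close>

lemma fold_decreases:
  fixes a b d q r :: int
  assumes "0 \<le> r" "r \<le> 1" "q \<noteq> 0"
  shows "a - b = 2 * q + r \<Longrightarrow>
      (3 * ((a - q) - (b + q)) - 1)\<^sup>2 + (3 * ((b + q) - d) - 1)\<^sup>2 + (3 * ((a - q) - d) - 2)\<^sup>2 <
      (3 * (a - b) - 1)\<^sup>2 + (3 * (b - d) - 1)\<^sup>2 + (3 * (a - d) - 2)\<^sup>2" (is "?ab \<Longrightarrow> ?A")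
    and "b - d = 2 * q + r \<Longrightarrow>
      (3 * (a - (b - q)) - 1)\<^sup>2 + (3 * ((b - q) - (d + q)) - 1)\<^sup>2 + (3 * (a - (d + q)) - 2)\<^sup>2 <
      (3 * (a - b) - 1)\<^sup>2 + (3 * (b - d) - 1)\<^sup>2 + (3 * (a - d) - 2)\<^sup>2" (is "?bd \<Longrightarrow> ?B")
    and "a - d = 2 * q + r \<Longrightarrow>
      (3 * ((a - q) - b) - 1)\<^sup>2 + (3 * (b - (d + q)) - 1)\<^sup>2 + (3 * ((a - q) - (d + q)) - 2)\<^sup>2 <
      (3 * (a - b) - 1)\<^sup>2 + (3 * (b - d) - 1)\<^sup>2 + (3 * (a - d) - 2)\<^sup>2" (is "?ad \<Longrightarrow> ?D")
proof -
  have pos: "0 < q * (3 * q + 3 * r - 1)" "0 < q * (3 * q + 3 * r - 2)"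
    using assms by (cases "q > 0"; auto simp: zero_less_mult_iff)+
  show ?A if ?ab
  proof -
    have a: "a = b + 2 * q + r" using that by simp
    show ?thesis using pos(1) unfolding a by (simp add: power2_eq_square algebra_simps)
  qed
  show ?B if ?bd
  proof -
    have b: "b = d + 2 * q + r" using that by simp
    show ?thesis using pos(1) unfolding b by (simp add: power2_eq_square algebra_simps)
  qed
  show ?D if ?ad
  proof -
    have a: "a = d + 2 * q + r" using that by simp
    show ?thesis using pos(2) unfolding a by (simp add: power2_eq_square algebra_simps)
  qed
qed

text \<open>Relative to \<open>d\<close> the triple is (0, 0, 0), (1, 0, 0) or (1, 1, 0), with sum
  \<open>3 * d\<close>, \<open>3 * d + 1\<close> or \<open>3 * d + 2\<close>. Thus the sum
  determines it.\<close>

lemma alcove_unique: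
  fixes a b d a' b' d' :: int
  assumes "a - b = 0 \<or> a - b = 1" "b - d = 0 \<or> b - d = 1" "a - d = 0 \<or> a - d = 1"
    "a' - b' = 0 \<or> a' - b' = 1" "b' - d' = 0 \<or> b' - d' = 1" "a' - d' = 0 \<or> a' - d' = 1"
    and "a + b + d = a' + b' + d'"
  shows "a = a' \<and> b = b' \<and> d = d'"
proof -
  have "a - b \<ge> 0" "b - d \<ge> 0" "a - d \<le> 1" "a' - b' \<ge> 0" "b' - d' \<ge> 0" "a' - d' \<le> 1"
    using assms by auto
  then have "a = a'" "d = d'" using assms(7) by linarith+
  then show ?thesis using assms(7) by simp
qed

context unit_sl3_web
begin

text \<open>\<open>C\<close> is connected and disjoint from every other strand, so each of them
  winds equally often around all points of \<open>C\<close>.\<close>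

lemma level_on_strand:
  assumes c: "tait_coloring G c" and ij: "i \<in> {1, 2, 3}" "j \<in> {1, 2, 3}" "i \<noteq> j"
    and C: "C \<in> dart_components G (kempe_darts G c i j)"
  shows "\<exists>K. \<forall>p\<in>curve_image \<phi> C. (\<Sum>C'\<in>dart_components G (kempe_darts G c i j) - {C}. wind C' p) = K"
proof -
  let ?\<C> = "dart_components G (kempe_darts G c i j)"
  have curve: "C' \<in> arc_curves G \<union> loop_curves G" if "C' \<in> ?\<C>" for C'
    using kempe_component_curve[OF c ij that] .
  have "\<exists>k. \<forall>p\<in>curve_image \<phi> C. wind C' p = k" if C': "C' \<in> ?\<C> - {C}" for C'
  proof -
    have "wind C' constant_on curve_image \<phi> C"
      using C' C curve_images_disjoint[OF c ij C, of C'] curve_image_subset[OF curve[OF C]]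
      by (intro wind_constant_on[OF curve]) auto
    then show ?thesis unfolding constant_on_def .
  qed
  then obtain k where "\<And>C' p. C' \<in> ?\<C> - {C} \<Longrightarrow> p \<in> curve_image \<phi> C \<Longrightarrow> wind C' p = k C'"
    by metis
  then have "\<forall>p\<in>curve_image \<phi> C. (\<Sum>C'\<in>?\<C> - {C}. wind C' p) = (\<Sum>C'\<in>?\<C> - {C}. k C')"
    by (intro ballI sum.cong) auto
  then show ?thesis by blast
qed

text \<open>
  Crossing the strand \<open>C\<close> changes \<open>\<Sum>C. wind C\<close> between \<open>K\<close> and \<open>K + t\<close> everywhere along \<open>C\<close>, so its
  parity also jumps by a constant \<open>s C * t\<close>; hence the two sides differ by a locally constant function.
\<close>
lemma sum_wind_mod_2:
  assumes c: "tait_coloring G c" and ij: "i \<in> {1, 2, 3}" "j \<in> {1, 2, 3}" "i \<noteq> j"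
  shows "\<exists>s. (\<forall>C. s C \<in> {1, -1}) \<and> (\<forall>z\<in>lower.
    (\<Sum>C\<in>dart_components G (kempe_darts G c i j). s C * wind C z) =
    (\<Sum>C\<in>dart_components G (kempe_darts G c i j). wind C z) mod 2)"
proof -
  let ?\<C> = "dart_components G (kempe_darts G c i j)"
  have curve: "C \<in> arc_curves G \<union> loop_curves G" if "C \<in> ?\<C>" for C
    using kempe_component_curve[OF c ij that] .
  have "\<forall>C\<in>?\<C>. \<exists>t\<in>{1, -1}. \<forall>z\<in>lower. wind C z \<in> {0, t}"
    using wind_sign curve by blast
  then obtain t where t: "\<And>C. C \<in> ?\<C> \<Longrightarrow> t C \<in> {1, -1 :: int}"
    "\<And>C z. C \<in> ?\<C> \<Longrightarrow> z \<in> lower \<Longrightarrow> wind C z \<in> {0, t C}"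
    by metis
  have "\<forall>C\<in>?\<C>. \<exists>K. \<forall>p\<in>curve_image \<phi> C. (\<Sum>C'\<in>?\<C> - {C}. wind C' p) = K"
    using level_on_strand[OF c ij] by blast
  then obtain K where K:
    "\<And>C p. C \<in> ?\<C> \<Longrightarrow> p \<in> curve_image \<phi> C \<Longrightarrow> (\<Sum>C'\<in>?\<C> - {C}. wind C' p) = K C"
    by metis
  \<comment> \<open>Passing from \<open>K C\<close> to \<open>K C + t C\<close> changes the parity
    by +1 if \<open>K C\<close> is even and by -1 if it is odd; \<open>s C * t C\<close> is to equal
    this change.\<close>
  define s :: "'e dart set \<Rightarrow> int" where "s C = (if even (K C) \<longleftrightarrow> t C = 1 then 1 else -1)" for C
  define u where "u z = (\<Sum>C\<in>?\<C>. s C * wind C z) - (\<Sum>C\<in>?\<C>. wind C z) mod 2" for z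
  have parity: "s C * wind C z - (K C + wind C z) mod 2 = - (K C mod 2)" if "C \<in> ?\<C>" "z \<in> lower" for C z
  proof (cases "wind C z = 0")
    case False
    then have "wind C z = t C" using t(2)[OF that] by blast
    moreover have "t C = 1 \<or> t C = - 1" using t(1)[OF that(1)] by blast
    ultimately show ?thesis
      by (elim disjE) (simp_all add: s_def, presburger+)
  qed simp
  have loc: "eventually (\<lambda>z. u p = u z) (at p within lower)" if p: "p \<in> lower" for p
  proof (cases "\<exists>C\<in>?\<C>. p \<in> curve_image \<phi> C")
    case False
    then have "\<forall>C\<in>?\<C>. eventually (\<lambda>z. wind C z = wind C p) (at p within lower)"
      using eventually_wind_const[OF curve p] by blast
    then have "eventually (\<lambda>z. \<forall>C\<in>?\<C>. wind C z = wind C p) (at p within lower)"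
      by (simp add: eventually_ball_finite)
    then show ?thesis
      by (rule eventually_mono) (simp add: u_def)
  next
    case True
    then obtain C where C: "C \<in> ?\<C>" "p \<in> curve_image \<phi> C" by blast
    have "eventually (\<lambda>z. \<forall>C'\<in>?\<C> - {C}. wind C' z = wind C' p) (at p within lower)"
    proof (rule eventually_ball_finite)
      show "\<forall>C'\<in>?\<C> - {C}. eventually (\<lambda>z. wind C' z = wind C' p) (at p within lower)"
      proof
        fix C' assume C': "C' \<in> ?\<C> - {C}"
        then have "p \<notin> curve_image \<phi> C'"
          using curve_images_disjoint[OF c ij C(1), of C'] C(2) by blast
        then show "eventually (\<lambda>z. wind C' z = wind C' p) (at p within lower)"
          using eventually_wind_const[OF curve p] C' by blast
      qed
    qed simp
    moreover have "eventually (\<lambda>z. z \<in> lower) (at p within lower)"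
      by (simp add: eventually_at_filter)
    ultimately have ev:
      "eventually (\<lambda>z. z \<in> lower \<and> (\<forall>C'\<in>?\<C> - {C}. wind C' z = wind C' p)) (at p within lower)"
      by (rule eventually_conj[rotated])
    \<comment> \<open>Near a point of \<open>C\<close> only \<open>wind C\<close> varies, and by
      \<open>parity\<close> its two values give the same \<open>u\<close>. The value 0 on
      \<open>C\<close> itself is one of them, so \<open>p\<close> is included.\<close>
    have split: "u z = (\<Sum>C'\<in>?\<C> - {C}. s C' * wind C' p) - K C mod 2"
      if "z \<in> lower" "\<forall>C'\<in>?\<C> - {C}. wind C' z = wind C' p" for z
    proof -
      have "(\<Sum>C\<in>?\<C>. wind C z) = wind C z + (\<Sum>C'\<in>?\<C> - {C}. wind C' z)"
        using C(1) by (simp add: sum.remove)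
      also have "(\<Sum>C'\<in>?\<C> - {C}. wind C' z) = (\<Sum>C'\<in>?\<C> - {C}. wind C' p)"
        using that(2) by (intro sum.cong) auto
      finally have 1: "(\<Sum>C\<in>?\<C>. wind C z) = K C + wind C z" using K[OF C] by simp
      have "(\<Sum>C\<in>?\<C>. s C * wind C z) = s C * wind C z + (\<Sum>C'\<in>?\<C> - {C}. s C' * wind C' z)"
        using C(1) by (simp add: sum.remove)
      also have "(\<Sum>C'\<in>?\<C> - {C}. s C' * wind C' z) = (\<Sum>C'\<in>?\<C> - {C}. s C' * wind C' p)"
        using that(2) by (intro sum.cong) auto
      finally show ?thesis using 1 parity[OF C(1) that(1)] by (simp add: u_def)
    qed
    show ?thesis
      by (rule eventually_mono[OF ev]) (simp add: split p)
  qed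
  have const: "u z = u z'" if "z \<in> lower" "z' \<in> lower" for z z'
    using connected_local_const[OF convex_connected[OF convex_lower] that] loc by blast
  have "\<forall>C\<in>?\<C>. \<exists>B. \<forall>z\<in>lower. B \<le> norm z \<longrightarrow> wind C z = 0"
    using wind_zero_at_infinity curve by blast
  then obtain B where B: "\<And>C z. C \<in> ?\<C> \<Longrightarrow> z \<in> lower \<Longrightarrow> B C \<le> norm z \<Longrightarrow> wind C z = 0"
    by metis
  \<comment> \<open>A point so far down the imaginary axis that it passes all the bounds, whence no
    strand winds around it.\<close>
  define z0 where "z0 = - of_real (\<Sum>C\<in>?\<C>. \<bar>B C\<bar>) * \<i>"
  have "(\<Sum>C\<in>?\<C>. \<bar>B C\<bar>) \<ge> 0" by (simp add: sum_nonneg)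
  then have z0: "z0 \<in> lower" "norm z0 = (\<Sum>C\<in>?\<C>. \<bar>B C\<bar>)"
    by (simp_all add: z0_def lower_def norm_mult del: of_real_sum)
  have "wind C z0 = 0" if "C \<in> ?\<C>" for C
  proof (rule B[OF that z0(1)])
    have "\<bar>B C\<bar> \<le> (\<Sum>C\<in>?\<C>. \<bar>B C\<bar>)" using that by (intro member_le_sum) auto
    then show "B C \<le> norm z0" using z0(2) by linarith
  qed
  then have "u z0 = 0" by (simp add: u_def)
  then have "\<forall>z\<in>lower. u z = 0" using const[OF _ z0(1)] by simp
  then show ?thesis
    by (intro exI[of _ s]) (auto simp: u_def s_def)
qed

section \<open>Kempe equivalence and simultaneous folding at all points\<close>

definition kempe_equivalent :: "('e \<Rightarrow> nat) \<Rightarrow> ('e \<Rightarrow> nat) \<Rightarrow> bool" where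
  "kempe_equivalent c c' \<longleftrightarrow>
     (strand_reversal 3 G w)\<^sup>*\<^sup>* (coloring_stranding G c) (coloring_stranding G c') \<and>
     (strand_reversal 3 G w)\<^sup>*\<^sup>* (coloring_stranding G c') (coloring_stranding G c)"

lemma kempe_equivalent_refl: "kempe_equivalent c c"
  by (simp add: kempe_equivalent_def)

lemma kempe_equivalent_trans:
  "kempe_equivalent c c' \<Longrightarrow> kempe_equivalent c' c'' \<Longrightarrow> kempe_equivalent c c''"
  unfolding kempe_equivalent_def by (meson rtranclp_trans)

text \<open>Swapping on \<open>U\<close> is an involution and keeps \<open>U\<close> closed, which
  provides the way back.\<close>

lemma kempe_equivalent_swap:
  assumes c: "tait_coloring G c" and ij: "1 \<le> i" "i < j" "j \<le> 3" and U: "kempe_closed G c i j U"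
  shows "kempe_equivalent c (swap_colors c i j U)"
proof -
  let ?c = "swap_colors c i j U"
  have "i \<in> {1, 2, 3}" "j \<in> {1, 2, 3}" using ij by auto
  then have c': "tait_coloring G ?c" using tait_swap_colors[OF c _ _ U] by blast
  have "?c e \<in> {i, j} \<longleftrightarrow> c e \<in> {i, j}" for e by (auto simp: swap_colors_def)
  then have "kempe_closed G ?c i j U" using U unfolding kempe_closed_def by simp
  moreover have "swap_colors ?c i j U = c" by (auto simp: swap_colors_def fun_eq_iff)
  ultimately show ?thesis
    unfolding kempe_equivalent_def
    using strand_reversals_swap[OF c ij U] strand_reversals_swap[OF c' ij] by metis
qed

text \<open>Reversing a strand negates its winding number in the level difference. Reversing those
  with \<open>s C = -1\<close> thus produces the signed sum of \<open>sum_wind_mod_2\<close>, which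
  is the parity at every point at once.\<close>

lemma fold_levels:
  assumes c: "tait_coloring G c" and ij: "1 \<le> i" "i < j" "j \<le> 3"
  obtains c' where "tait_coloring G c'"
    "kempe_equivalent c c'"
    "\<And>z. z \<in> regular \<Longrightarrow> level c' i z - level c' j z = (level c i z - level c j z) mod 2"
    "\<And>z. z \<in> regular \<Longrightarrow> level c' i z + level c' j z = level c i z + level c j z"
    "\<And>k z. z \<in> regular \<Longrightarrow> k \<in> {1, 2, 3} \<Longrightarrow> k \<noteq> i \<Longrightarrow> k \<noteq> j \<Longrightarrow> level c' k z = level c k z"
proof -
  have ij': "i \<in> {1, 2, 3}" "j \<in> {1, 2, 3}" "i \<noteq> j" using ij by auto
  let ?\<C> = "dart_components G (kempe_darts G c i j)"
  obtain s :: "'e dart set \<Rightarrow> int" where s: "\<And>C. s C \<in> {1, -1}"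
    and mod2: "\<And>z. z \<in> lower \<Longrightarrow> (\<Sum>C\<in>?\<C>. s C * wind C z) = (\<Sum>C\<in>?\<C>. wind C z) mod 2"
    using sum_wind_mod_2[OF c ij'] by blast
  define U where "U = (\<Union>C\<in>{C\<in>?\<C>. s C = -1}. fst ` C)"
  define c' where "c' = swap_colors c i j U"
  define F :: "'e \<Rightarrow> int" where "F e = (if e \<in> U then -1 else 1)" for e
  have U: "kempe_closed G c i j U"
    unfolding U_def by (rule kempe_closed_UN) (simp add: kempe_closed_component)
  have c': "tait_coloring G c'"
    unfolding c'_def by (rule tait_swap_colors[OF c ij'(1,2) U])
  have F: "F (fst d) = s C" if C: "C \<in> ?\<C>" "d \<in> C" for C d
  proof -
    \<comment> \<open>An edge lies in one strand only, so membership in \<open>U\<close> depends on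
      its strand alone.\<close>
    have "fst d \<in> U \<longleftrightarrow> s C = -1"
    proof
      assume "fst d \<in> U"
      then obtain C' d' where C': "C' \<in> ?\<C>" "s C' = -1" "d' \<in> C'" "fst d' = fst d"
        by (auto simp: U_def)
      have "curve_verts G {d'} = curve_verts G {d}"
        using C'(4) unfolding curve_verts_single dart_ends[symmetric] by simp
      then have "curve_verts G C' \<inter> curve_verts G C \<noteq> {}"
        using C'(3) C(2) by (auto simp: curve_verts_def)
      then have "C' = C" using dart_components_disjoint[OF C'(1) C(1)] by blast
      then show "s C = -1" using C'(2) by simp
    qed (use C in \<open>auto simp: U_def\<close>)
    then show ?thesis using s[of C] by (auto simp: F_def)
  qed
  have "complex_of_int (level c' i z - level c' j z) = of_int ((level c i z - level c j z) mod 2)"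
    if z: "z \<in> regular" for z
  proof -
    have "complex_of_int (level c' i z - level c' j z) = height c' i z - height c' j z"
      using z c' ij' by (simp add: height_eq_level)
    also have "\<dots> = (\<Sum>e\<in>arcs G. of_int (F e) * ((of_bool (c e = i) - of_bool (c e = j)) * edge_weight e z))"
      unfolding height_def sum_subtractf[symmetric]
      by (rule sum.cong) (use ij'(3) in \<open>auto simp: c'_def F_def swap_colors_def\<close>)
    also have "\<dots> = of_int (\<Sum>C\<in>?\<C>. s C * wind C z)"
      by (rule sum_over_components[OF c ij' z]) (rule F)
    also have "(\<Sum>C\<in>?\<C>. s C * wind C z) = (level c i z - level c j z) mod 2"
      using mod2[of z] z level_diff[OF c ij' z] by (simp add: regular_def)
    finally show ?thesis .
  qed
  then have 1: "level c' i z - level c' j z = (level c i z - level c j z) mod 2" if "z \<in> regular" for z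
    using that by (simp only: of_int_eq_iff)
  have 2: "level c' i z + level c' j z = level c i z + level c j z" if z: "z \<in> regular" for z
  proof -
    have "height c' i z + height c' j z = height c i z + height c j z"
      unfolding height_def sum.distrib[symmetric]
      by (rule sum.cong) (use ij'(3) in \<open>auto simp: c'_def swap_colors_def\<close>)
    then have "complex_of_int (level c' i z + level c' j z) = of_int (level c i z + level c j z)"
      using z c c' ij' by (simp add: height_eq_level algebra_simps)
    then show ?thesis by (simp only: of_int_eq_iff)
  qed
  have 3: "level c' k z = level c k z" if "k \<noteq> i" "k \<noteq> j" for k z
  proof -
    have "c' e = k \<longleftrightarrow> c e = k" for e
      using that by (auto simp: c'_def swap_colors_def)
    then show ?thesis by (simp add: level_def height_def)
  qed
  have "kempe_equivalent c c'"
    unfolding c'_def by (rule kempe_equivalent_swap[OF c ij U])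
  then show thesis using that[of c'] c' 1 2 3 by blast
qed

definition folded_at :: "('e \<Rightarrow> nat) \<Rightarrow> complex \<Rightarrow> bool" where
  "folded_at c z \<longleftrightarrow> level c 1 z - level c 2 z \<in> {0, 1} \<and> level c 2 z - level c 3 z \<in> {0, 1} \<and>
     level c 1 z - level c 3 z \<in> {0, 1}"

text \<open>
  With \<open>x\<^sub>i = level c i z\<close>, this is up to scaling the squared distance from \<open>x\<close> to the barycentre of the alcove
  \<open>{0 \<le> x\<^sub>1 - x\<^sub>2, 0 \<le> x\<^sub>2 - x\<^sub>3, x\<^sub>1 - x\<^sub>3 \<le> 1}\<close>. Reducing \<open>x\<^sub>i - x\<^sub>j\<close> modulo 2 is a composition of
  reflections that each bring the point closer to this alcove.
\<close>
definition alcove_dist :: "('e \<Rightarrow> nat) \<Rightarrow> complex \<Rightarrow> int" where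
  "alcove_dist c z = (3 * (level c 1 z - level c 2 z) - 1)\<^sup>2 + (3 * (level c 2 z - level c 3 z) - 1)\<^sup>2 +
     (3 * (level c 1 z - level c 3 z) - 2)\<^sup>2"

text \<open>If the gap is \<open>2 * q + r\<close>, the new gap \<open>r\<close> and the unchanged
  sum force a shift of \<open>q\<close> from level \<open>i\<close> to level \<open>j\<close>.
  Points with \<open>q = 0\<close> stay put, all others come closer to the alcove.\<close>

lemma fold_step:
  assumes c: "tait_coloring G c" and ij: "1 \<le> i" "i < j" "j \<le> 3"
  obtains c' where "tait_coloring G c'"
    "kempe_equivalent c c'"
    "\<And>z. z \<in> regular \<Longrightarrow> (if level c i z - level c j z \<in> {0, 1}
       then \<forall>k\<in>{1, 2, 3}. level c' k z = level c k z else alcove_dist c' z < alcove_dist c z)"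
proof -
  obtain c' where c': "tait_coloring G c'"
    "kempe_equivalent c c'"
    "\<And>z. z \<in> regular \<Longrightarrow> level c' i z - level c' j z = (level c i z - level c j z) mod 2"
    "\<And>z. z \<in> regular \<Longrightarrow> level c' i z + level c' j z = level c i z + level c j z"
    "\<And>k z. z \<in> regular \<Longrightarrow> k \<in> {1, 2, 3} \<Longrightarrow> k \<noteq> i \<Longrightarrow> k \<noteq> j \<Longrightarrow> level c' k z = level c k z"
    by (rule fold_levels[OF c ij]) (rule that)
  show thesis
  proof (rule that[OF c'(1,2)])
    fix z assume z: "z \<in> regular"
    define q r where "q = (level c i z - level c j z) div 2" and "r = (level c i z - level c j z) mod 2"
    have qr: "0 \<le> r" "r \<le> 1" "level c i z - level c j z = 2 * q + r"
      by (auto simp: q_def r_def)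
    have d: "level c' i z - level c' j z = r" using c'(3)[OF z] by (simp add: r_def)
    have new: "level c' i z = level c i z - q" "level c' j z = level c j z + q"
      using d qr(3) c'(4)[OF z] by linarith+
    note other = c'(5)[OF z]
    show "if level c i z - level c j z \<in> {0, 1}
       then \<forall>k\<in>{1, 2, 3}. level c' k z = level c k z else alcove_dist c' z < alcove_dist c z"
    proof (cases "q = 0")
      case True
      then have "level c i z - level c j z \<in> {0, 1}"
        using qr by auto
      moreover have "level c' k z = level c k z" if "k \<in> {1, 2, 3}" for k
        using other[OF that] new True by (cases "k = i"; cases "k = j") auto
      ultimately show ?thesis by simp
    next
      case False
      note decr = fold_decreases[OF qr(1,2) False]
      have "i = 1 \<and> j = 2 \<or> i = 2 \<and> j = 3 \<or> i = 1 \<and> j = 3" using ij by auto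
      then consider "i = 1" "j = 2" | "i = 2" "j = 3" | "i = 1" "j = 3" by blast
      then have "alcove_dist c' z < alcove_dist c z"
      proof cases
        case 1
        then have "level c' 3 z = level c 3 z" using other[of 3] by simp
        then show ?thesis
          unfolding alcove_dist_def new[unfolded 1] using decr(1)[OF qr(3)[unfolded 1]] by simp
      next
        case 2
        then have "level c' 1 z = level c 1 z" using other[of 1] by simp
        then show ?thesis
          unfolding alcove_dist_def new[unfolded 2] using decr(2)[OF qr(3)[unfolded 2]] by simp
      next
        case 3
        then have "level c' 2 z = level c 2 z" using other[of 2] by simp
        then show ?thesis
          unfolding alcove_dist_def new[unfolded 3] using decr(3)[OF qr(3)[unfolded 3]] by simp
      qed
      moreover have "level c i z - level c j z \<notin> {0, 1}"
        using qr False by auto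
      ultimately show ?thesis by simp
    qed
  qed
qed

text \<open>If none of the three folds moves \<open>z\<close>, all three gaps were in {0, 1}
  throughout and \<open>z\<close> is folded. Otherwise some fold lowers the distance and none raises
  it. A point already folded is never moved.\<close>

lemma fold_round:
  assumes c: "tait_coloring G c"
  obtains c' where "tait_coloring G c'"
    "kempe_equivalent c c'"
    "\<And>z. z \<in> regular \<Longrightarrow> folded_at c' z \<or> \<not> folded_at c z \<and> alcove_dist c' z < alcove_dist c z"
proof -
  let ?step = "\<lambda>a b i j. \<forall>z\<in>regular. (if level a i z - level a j z \<in> {0, 1}
       then \<forall>k\<in>{1, 2, 3}. level b k z = level a k z else alcove_dist b z < alcove_dist a z)"
  have step: "\<exists>b. tait_coloring G b \<and> kempe_equivalent a b \<and> ?step a b i j"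
    if a: "tait_coloring G a" and ij: "1 \<le> i" "i < j" "j \<le> 3" for a i j
    by (rule fold_step[OF a ij]) blast
  obtain c1 where c1: "tait_coloring G c1" "kempe_equivalent c c1" "?step c c1 1 2"
    using step[OF c, of 1 2] by auto
  obtain c2 where c2: "tait_coloring G c2" "kempe_equivalent c1 c2" "?step c1 c2 2 3"
    using step[OF c1(1), of 2 3] by auto
  obtain c3 where c3: "tait_coloring G c3" "kempe_equivalent c2 c3" "?step c2 c3 1 3"
    using step[OF c2(1), of 1 3] by auto
  have "folded_at c3 z \<or> \<not> folded_at c z \<and> alcove_dist c3 z < alcove_dist c z" if z: "z \<in> regular" for z
  proof -
    have eq: "alcove_dist a z = alcove_dist b z" if "\<forall>k\<in>{1, 2, 3}. level a k z = level b k z" for a b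
      using that by (simp add: alcove_dist_def)
    note s = bspec[OF c1(3) z] bspec[OF c2(3) z] bspec[OF c3(3) z]
    have le: "alcove_dist c1 z \<le> alcove_dist c z" "alcove_dist c2 z \<le> alcove_dist c1 z"
      "alcove_dist c3 z \<le> alcove_dist c2 z"
      using s eq[of c1 c] eq[of c2 c1] eq[of c3 c2] by (auto split: if_splits)
    show ?thesis
    proof (cases "level c 1 z - level c 2 z \<in> {0, 1} \<and> level c1 2 z - level c1 3 z \<in> {0, 1} \<and>
        level c2 1 z - level c2 3 z \<in> {0, 1}")
      case True
      then have "folded_at c3 z" using s by (simp add: folded_at_def)
      then show ?thesis ..
    next
      case False
      moreover from this have "\<not> folded_at c z"
        using s by (auto simp: folded_at_def)
      moreover have "alcove_dist c1 z < alcove_dist c z \<or> alcove_dist c2 z < alcove_dist c1 z \<or>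
          alcove_dist c3 z < alcove_dist c2 z"
        using False s by presburger
      ultimately show ?thesis using le by linarith
    qed
  qed
  moreover have "kempe_equivalent c c3"
    using c1(2) c2(2) c3(2) by (meson kempe_equivalent_trans)
  ultimately show thesis using that c3(1) by blast
qed

text \<open>A bound uniform in \<open>z\<close> is needed for the induction. Each gap is a sum of
  strand winding numbers of absolute value at most 1, so the number of strands bounds it.\<close>

lemma alcove_dist_bounded:
  assumes c: "tait_coloring G c"
  obtains N :: nat where "\<And>z. z \<in> regular \<Longrightarrow> alcove_dist c z \<le> int N"
proof -
  define m where "m i j = int (card (dart_components G (kempe_darts G c i j)))" for i j
  have bound: "\<bar>level c i z - level c j z\<bar> \<le> m i j"
    if ij: "i \<in> {1, 2, 3}" "j \<in> {1, 2, 3}" "i \<noteq> j" and z: "z \<in> regular" for i j z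
  proof -
    have "\<bar>wind C z\<bar> \<le> 1" if "C \<in> dart_components G (kempe_darts G c i j)" for C
      using wind_sign[OF kempe_component_curve[OF c ij that]] z by (force simp: regular_def)
    then have "\<bar>\<Sum>C\<in>dart_components G (kempe_darts G c i j). wind C z\<bar> \<le>
        (\<Sum>C\<in>dart_components G (kempe_darts G c i j). 1)"
      by (intro order_trans[OF sum_abs] sum_mono)
    then show ?thesis by (simp add: level_diff[OF c ij z] m_def)
  qed
  have sq: "(3 * x - a)\<^sup>2 \<le> (3 * k + 2)\<^sup>2" if "\<bar>x\<bar> \<le> k" "0 \<le> a" "a \<le> 2" for x k a :: int
    using that by (intro abs_le_square_iff[THEN iffD1]) linarith
  have "alcove_dist c z \<le> (3 * m 1 2 + 2)\<^sup>2 + (3 * m 2 3 + 2)\<^sup>2 + (3 * m 1 3 + 2)\<^sup>2"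
    if z: "z \<in> regular" for z
    unfolding alcove_dist_def
    by (intro add_mono sq bound) (use z in auto)
  then show thesis
    by (intro that[of "nat ((3 * m 1 2 + 2)\<^sup>2 + (3 * m 2 3 + 2)\<^sup>2 + (3 * m 1 3 + 2)\<^sup>2)"]) simp
qed

text \<open>Distances are nonnegative integers, so each round lowers the uniform bound at the
  unfolded points by at least 1, and at bound 0 none is left.\<close>

lemma ex_folded:
  assumes c: "tait_coloring G c"
  obtains c' where "tait_coloring G c'"
    "kempe_equivalent c c'"
    "\<And>z. z \<in> regular \<Longrightarrow> folded_at c' z"
proof -
  have *: "\<exists>c'. tait_coloring G c' \<and> kempe_equivalent c c' \<and>
      (\<forall>z\<in>regular. folded_at c' z)"
    if "tait_coloring G c" "\<forall>z\<in>regular. folded_at c z \<or> alcove_dist c z < int N" for c N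
    using that
  proof (induction N arbitrary: c)
    case 0
    have "\<not> alcove_dist c z < int 0" for z by (simp add: alcove_dist_def not_less)
    then have "\<forall>z\<in>regular. folded_at c z" using 0(2) by blast
    then show ?case using 0(1) kempe_equivalent_refl by blast
  next
    case (Suc N)
    obtain c1 where c1: "tait_coloring G c1" "kempe_equivalent c c1"
      "\<And>z. z \<in> regular \<Longrightarrow> folded_at c1 z \<or> \<not> folded_at c z \<and> alcove_dist c1 z < alcove_dist c z"
      by (rule fold_round[OF Suc.prems(1)]) (rule that)
    have "folded_at c1 z \<or> alcove_dist c1 z < int N" if "z \<in> regular" for z
      using c1(3)[OF that] bspec[OF Suc.prems(2) that] by linarith
    then obtain c' where "tait_coloring G c'" "kempe_equivalent c1 c'"
      "\<forall>z\<in>regular. folded_at c' z"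
      using Suc.IH[OF c1(1)] by blast
    then show ?case using c1(2) by (meson kempe_equivalent_trans)
  qed
  obtain N where N: "\<And>z. z \<in> regular \<Longrightarrow> alcove_dist c z \<le> int N"
    using alcove_dist_bounded[OF c] by blast
  have "alcove_dist c z < int (Suc N)" if "z \<in> regular" for z
    using N[OF that] by simp
  then show thesis using *[OF c, of "Suc N"] that by blast
qed

subsection \<open>The folded coloring is unique\<close>

lemma folded_levels_eq:
  assumes c: "tait_coloring G c" "tait_coloring G c'" and z: "z \<in> regular"
    and f: "folded_at c z" "folded_at c' z" and k: "k \<in> {1, 2, 3}"
  shows "level c k z = level c' k z"
proof -
  have "level c 1 z = level c' 1 z \<and> level c 2 z = level c' 2 z \<and> level c 3 z = level c' 3 z"
    using sum_level_indep[OF c z] f unfolding folded_at_def by (intro alcove_unique) simp_all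
  then show ?thesis using k by auto
qed

text \<open>Strictly below the axis \<open>p\<close> also avoids the cap segments, where the caps
  could jump.\<close>

lemma isCont_edge_weight:
  assumes e: "e \<in> arcs G" and p: "Im p < 0" "p \<notin> path_image (\<phi> e)"
  shows "isCont (edge_weight e) p"
proof -
  have cap: "isCont (cap v) p" for v
  proof (cases "v \<in> boundary_axis")
    case True
    then have "p \<notin> path_image (linepath \<i> v)"
      using segment_from_i(1)[of p v] p(1) by auto
    moreover have "cap v = winding_number (linepath \<i> v)" using True by (simp add: cap_def fun_eq_iff)
    ultimately show ?thesis using continuous_at_winding_number[of "linepath \<i> v" p] by simp
  next
    case False
    then have "cap v = (\<lambda>_. 0)" by (simp add: cap_def fun_eq_iff)
    then show ?thesis by simp
  qed
  have "edge_weight e = (\<lambda>z. winding_number (\<phi> e) z + cap (tail G e) z - cap (head G e) z)"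
    by (simp add: edge_weight_def fun_eq_iff)
  then show ?thesis
    using continuous_at_winding_number[OF path_edge[OF e] p(2)] cap by simp
qed

text \<open>
  If \<open>e\<close> had color \<open>i\<close> only in \<open>c\<close>, then equality of the heights would make \<open>edge_weight e\<close> continuous
  across \<open>e\<close>, hence also the winding number of a strand through \<open>e\<close>.
\<close>
lemma levels_determine_coloring:
  assumes c: "tait_coloring G c" "tait_coloring G c'"
    and eq: "\<And>z k. z \<in> regular \<Longrightarrow> k \<in> {1, 2, 3} \<Longrightarrow> level c k z = level c' k z"
    and e: "e \<in> arcs G"
  shows "c e = c' e"
proof (rule ccontr)
  assume ne: "c e \<noteq> c' e"
  define i j where "i = c e" and "j = c' e"
  have ij: "i \<in> {1, 2, 3}" "j \<in> {1, 2, 3}" "i \<noteq> j"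
    using tait_colors[OF c(1) e] tait_colors[OF c(2) e] ne by (auto simp: i_def j_def)
  define p where "p = \<phi> e (1/2)"
  have half: "(1/2::real) \<in> {0<..<1}" by simp
  then have p: "p \<in> \<phi> e ` {0<..<1}" unfolding p_def by (rule imageI)
  then have Im: "Im p < 0" and pv: "p \<notin> verts G" and pe: "p \<in> path_image (\<phi> e)"
    using edge_interior[OF e] path_image_edge[OF e] by auto
  have other: "p \<notin> path_image (\<phi> e')" if "e' \<in> arcs G" "e' \<noteq> e" for e'
    using edges_Int[OF e that(1) that(2)[symmetric] pe] pv that(1) by auto
  obtain C where C: "C \<in> dart_components G (kempe_darts G c i j)" "(e, True) \<in> C"
    by (rule dart_components_cover[of "(e, True)" "kempe_darts G c i j"]) (use e in \<open>auto simp: i_def\<close>)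
  note curve = kempe_component_curve[OF c(1) ij C(1)]
  have finC: "finite C" using dart_component_subset[OF C(1)] finite_subset finite_kempe_darts by blast
  have pC: "p \<in> curve_image \<phi> C" using C(2) pe by (force simp: curve_image_def)
  \<comment> \<open>\<open>f\<close> is the winding number of \<open>C\<close> rewritten with the
    weight of \<open>e\<close> eliminated by the equality of heights for color \<open>i\<close>.
    Only edges that miss \<open>p\<close> remain, so it is continuous there.\<close>
  define f where "f z = (\<Sum>e'\<in>arcs G - {e}. (of_bool (c' e' = i) - of_bool (c e' = i)) * edge_weight e' z)
      + (\<Sum>d\<in>C - {(e, True)}. dart_weight d z)" for z
  have "isCont f p"
  proof -
    have "isCont (dart_weight d) p" if d: "d \<in> C - {(e, True)}" for d
    proof -
      have d': "fst d \<in> arcs G" using component_arcs[OF C(1)] d by auto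
      have "fst d \<noteq> e"
        using d C(2) inj_onD[OF curve_inj_fst[OF curve], of d "(e, True)"] by auto
      then have "isCont (edge_weight (fst d)) p"
        using isCont_edge_weight[OF d' Im other[OF d']] by blast
      moreover have "dart_weight d = (if snd d then edge_weight (fst d) else (\<lambda>z. - edge_weight (fst d) z))"
        by (simp add: dart_weight_def fun_eq_iff)
      ultimately show ?thesis by simp
    qed
    moreover have "isCont (edge_weight e') p" if "e' \<in> arcs G - {e}" for e'
      using isCont_edge_weight[OF _ Im other] that by blast
    ultimately show ?thesis
      unfolding f_def by (intro continuous_intros) auto
  qed
  then obtain r where r: "r > 0" "\<And>z. dist z p < r \<Longrightarrow> dist (f z) (f p) < 1/2"
    unfolding continuous_at_eps_delta by (metis half_gt_zero_iff zero_less_one)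
  \<comment> \<open>All edges except \<open>e\<close> are removed, and \<open>e\<close> belongs to
    \<open>C\<close>; so the points of \<open>S\<close> off \<open>C\<close> are regular.\<close>
  define S where "S = ball p r \<inter> {z. Im z < 0} - (\<Union>e'\<in>arcs G - {e}. path_image (\<phi> e'))"
  have "closed (\<Union>e'\<in>arcs G - {e}. path_image (\<phi> e'))"
    by (intro closed_UN) (auto intro: closed_path_image path_edge)
  moreover have "open {z. Im z < 0}" by (intro open_Collect_less continuous_intros)
  ultimately have "open S" unfolding S_def by (intro open_Diff open_Int) auto
  moreover have "p \<in> S" using r(1) Im other by (auto simp: S_def)
  moreover have "S \<subseteq> lower" by (auto simp: S_def lower_def)
  ultimately obtain z1 z2 where z: "z1 \<in> S - curve_image \<phi> C" "z2 \<in> S - curve_image \<phi> C"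
      "wind C z1 \<noteq> wind C z2"
    using wind_jump[OF curve pC] by metis
  have f: "of_int (wind C z) = f z" if zS: "z \<in> S - curve_image \<phi> C" for z
  proof -
    have "z \<notin> path_image (\<phi> e)" using zS C(2) by (force simp: curve_image_def)
    then have reg: "z \<in> regular"
      using zS by (auto simp: S_def regular_def lower_def graph_image_def)
    \<comment> \<open>In color \<open>i\<close> the edge \<open>e\<close> counts for
      \<open>c\<close> but not for \<open>c'\<close>, so this equality can be solved for its
      weight.\<close>
    have "height c i z = height c' i z"
      using height_eq_level[OF c(1) ij(1) reg] height_eq_level[OF c(2) ij(1) reg] eq[OF reg ij(1)] by simp
    moreover have "height c i z = edge_weight e z + (\<Sum>e'\<in>arcs G - {e}. of_bool (c e' = i) * edge_weight e' z)"
      unfolding height_def by (subst sum.remove[OF finite_arcs e]) (simp add: i_def)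
    moreover have "height c' i z = (\<Sum>e'\<in>arcs G - {e}. of_bool (c' e' = i) * edge_weight e' z)"
      unfolding height_def using ij(3) by (subst sum.remove[OF finite_arcs e]) (simp add: j_def)
    ultimately have "edge_weight e z =
        (\<Sum>e'\<in>arcs G - {e}. (of_bool (c' e' = i) - of_bool (c e' = i)) * edge_weight e' z)"
      by (simp only: left_diff_distrib sum_subtractf) (simp add: algebra_simps)
    moreover have "(\<Sum>d\<in>C. dart_weight d z) = edge_weight e z + (\<Sum>d\<in>C - {(e, True)}. dart_weight d z)"
      using sum.remove[OF finC C(2), of "\<lambda>d. dart_weight d z"] by (simp add: dart_weight_def)
    moreover have "(\<Sum>d\<in>C. dart_weight d z) = of_int (wind C z)"
      using zS by (intro sum_dart_weight[OF curve]) (auto simp: S_def lower_def)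
    ultimately show ?thesis by (simp add: f_def)
  qed
  have "dist z1 p < r" "dist z2 p < r"
    using z(1,2) unfolding S_def by (simp_all add: dist_commute)
  then have "dist (f z1) (f z2) < 1"
    using dist_triangle_half_l[OF r(2) r(2)] by blast
  then have "norm (complex_of_int (wind C z1 - wind C z2)) < 1"
    using f[OF z(1)] f[OF z(2)] by (simp add: dist_norm)
  then have "real_of_int \<bar>wind C z1 - wind C z2\<bar> < 1"
    unfolding norm_of_int by simp
  then show False using z(3) by linarith
qed

lemma kempe_equivalent_all:
  assumes c: "tait_coloring G c" "tait_coloring G d"
  shows "(strand_reversal 3 G w)\<^sup>*\<^sup>* (coloring_stranding G c) (coloring_stranding G d)"
proof -
  obtain c' where c': "tait_coloring G c'" "kempe_equivalent c c'" "\<And>z. z \<in> regular \<Longrightarrow> folded_at c' z"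
    using ex_folded[OF c(1)] by blast
  obtain d' where d': "tait_coloring G d'" "kempe_equivalent d d'" "\<And>z. z \<in> regular \<Longrightarrow> folded_at d' z"
    using ex_folded[OF c(2)] by blast
  have "c' e = d' e" if "e \<in> arcs G" for e
    by (rule levels_determine_coloring[OF c'(1) d'(1) folded_levels_eq[OF c'(1) d'(1)] that])
      (use c'(3) d'(3) in auto)
  then have "coloring_stranding G c' = coloring_stranding G d'"
    by (rule coloring_stranding_cong)
  then show ?thesis
    using c'(2) d'(2) unfolding kempe_equivalent_def by (metis rtranclp_trans)
qed

end

theorem corollary69:
  fixes G :: "(complex, 'e) pre_digraph"
    and \<phi> :: "'e \<Rightarrow> real \<Rightarrow> complex"
    and w :: "'e \<Rightarrow> nat"
    and S T :: "'e stranding"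
  assumes "sl_web 3 G \<phi> w"
    and "\<forall>e \<in> arcs G. w e = 1"
    and "valid_stranding 3 G w S"
    and "valid_stranding 3 G w T"
  shows "(strand_reversal 3 G w)\<^sup>*\<^sup>* S T"
proof -
  interpret unit_sl3_web G \<phi> w
    using assms(1,2) by unfold_locales
  obtain c where c: "tait_coloring G c" "S = coloring_stranding G c"
    using valid_stranding_coloring[OF assms(3)] .
  obtain d where d: "tait_coloring G d" "T = coloring_stranding G d"
    using valid_stranding_coloring[OF assms(4)] .
  show ?thesis
    using kempe_equivalent_all[OF c(1) d(1)] c(2) d(2) by simp
qed

end
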